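(* For all integers $k\ge 1$, \[ 2^{-k}\sqrt{k}\ \ge\ \mathcal{B}_{\frac12}(2^{-k})\ \ge\ 0.997\cdot 2^{-k}\sqrt{k}. \] In particular, $0.5\ge \mathcal{B}_{\frac12}(\tfrac12)\ge 0.4985$.
   Context: The Hamming cube $\{0,1\}^n$ is viewed as a graph in which two vertices are joined by an edge iff they differ in exactly one coordinate. For $A\subset\{0,1\}^n$ and $x\in A$, $h_A(x)$ is the number of edges connecting $x$ with the complement of $A$; $h_A(x)=0$ if $x\notin A$. For $f:\{0,1\}^n\to\mathbb{R}$, $\mathbf{E}f=2^{-n}\sum_{x}f(x)$, and $|A|=\mathbf{E}\mathbf{1}_A=2^{-n}\#A$. For $\beta\in[\frac12,1]$ and a dyadic rational $x\in\mathcal{Q}=\{k2^{-n}: n\ge 0,\ 0\le k\le 2^n\}$, the $\beta$-isoperimetric profile is \[ \mathcal{B}_\beta(x)=\inf_{n\ge 1}\ \inf_{A\subset\{0,1\}^n,\ |A|=x}\mathbf{E}\,h_A^\beta . \] *)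

theory Defs
  imports "HOL-Analysis.Analysis"
begin

text \<open>Points of the Hamming cube are Boolean lists of length \<open>n\<close>.\<close>

definition cube :: "nat \<Rightarrow> bool list set" where
  "cube n = {x. length x = n}"

definition cube_adj :: "nat \<Rightarrow> bool list \<Rightarrow> bool list \<Rightarrow> bool" where
  "cube_adj n x y \<longleftrightarrow>
     x \<in> cube n \<and> y \<in> cube n \<and> card {i. i < n \<and> x ! i \<noteq> y ! i} = 1"

text \<open>The cube is a simple graph, so the edges from \<open>x\<close> to the complement of \<open>A\<close>
  are counted by their endpoints outside \<open>A\<close>.\<close>

definition edge_bdry :: "nat \<Rightarrow> bool list set \<Rightarrow> bool list \<Rightarrow> nat" where
  "edge_bdry n A x = (if x \<in> A then card {y \<in> cube n - A. cube_adj n x y} else 0)"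

definition cube_mean :: "nat \<Rightarrow> (bool list \<Rightarrow> real) \<Rightarrow> real" where
  "cube_mean n f = (\<Sum>x\<in>cube n. f x) / 2 ^ n"

definition cube_density :: "nat \<Rightarrow> bool list set \<Rightarrow> real" where
  "cube_density n A = cube_mean n (indicat_real A)"

text \<open>The infima are taken in the extended reals: for a dyadic rational \<open>x\<close> the inner infimum
  ranges over the empty set when \<open>x\<close> is not a multiple of \<open>1 / 2 ^ n\<close>, and then has to be
  \<open>\<infinity>\<close>.  Note also that \<open>0 powr \<beta> = 0\<close>, as it should be for \<open>\<beta> \<ge> 1/2\<close>.\<close>

definition iso_profile :: "real \<Rightarrow> real \<Rightarrow> ereal" where
  "iso_profile \<beta> x =
     (INF n\<in>{1..}. INF A\<in>{A. A \<subseteq> cube n \<and> cube_density n A = x}.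
        ereal (cube_mean n (\<lambda>y. real (edge_bdry n A y) powr \<beta>)))"

end

theory Submission
  imports Defs
begin

text \<open>
  The upper bound comes from a subcube of codimension \<open>k\<close>, which already appears as a single vertex
  of the \<open>k\<close>-dimensional cube.

  The lower bound uses a Bellman function.  Split a set \<open>A\<close> by one coordinate into two slices with
  densities \<open>x \<le> y\<close>.  A proportion of at least \<open>y - x\<close> of the points of the denser half have no
  partner in the other slice, and each of them gains one boundary edge.  If \<open>b\<close> is the mean root
  boundary of the denser slice, then with \<open>d = y - x\<close> the gain raises \<open>b\<close> at least to \<open>sqrt (d\<^sup>2 + b\<^sup>2)\<close>, by
  the triangle inequality in the plane, and also at least to \<open>d + (sqrt 2 - 1) * b\<close>, because edge
  counts are integers.  Consequently every nonnegative function \<open>B\<close> on \<open>[0, 1]\<close> that vanishes at the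
  ends and satisfies
  \<open>2 * B ((x + y) / 2) \<le> B x + max (sqrt (d\<^sup>2 + (B y)\<^sup>2)) (d + (sqrt 2 - 1) * B y)\<close>
  bounds the mean root boundary from below (\<open>two_point_induction\<close>).

  It remains to find such a \<open>B\<close> with \<open>B x \<ge> 0.997 * ell x\<close> for \<open>x \<le> 1 / 2\<close>, where
  \<open>ell x = x * sqrt (log 2 (1 / x))\<close> is the value of subcubes.  The function \<open>ell\<close> itself has the
  two-point property at small densities (\<open>ell_two_point\<close>), but its slope at \<open>1 / 2\<close> is too large: the
  two-point inequality bounds the curvature of \<open>B\<close> by \<open>- B * B'' \<le> 2\<close> and excludes concave kinks, so a
  continuation of \<open>ell\<close> beyond \<open>1 / 2\<close> could not return to \<open>0\<close> at \<open>1\<close>.  The loss of \<open>0.3\<close> percent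
  makes room for a flatter function: \<open>bellman\<close> is the maximum of \<open>0.997 * ell\<close> and a parabola up to
  \<open>1 / 2\<close>, and from there on a polynomial of degree six that vanishes at \<open>1\<close>.

  The two-point inequality for \<open>bellman\<close> (\<open>bellman_two_point\<close>) is split according to the function that
  is active at the midpoint.  For \<open>ell\<close> it is an inequality in the ratio \<open>x / y\<close>.  For the parabola the
  second difference is constant, so that with \<open>y\<close> fixed the inequality is concave in the distance
  or in its square, and only the extreme distances matter.  If \<open>x\<close> and \<open>y\<close> both exceed \<open>1 / 2\<close>, one moves \<open>x\<close>
  away from \<open>y\<close> and compares derivatives.  What is left are polynomial inequalities in one or two
  variables on intervals and boxes, some of them with a margin of less than \<open>0.001\<close>.  They are proved
  by a verified procedure that bisects the box and bounds the polynomial on each part.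
\<close>

section \<open>Edge boundaries and slices of the cube\<close>

lemma cube_0: "cube 0 = {[]}"
  by (auto simp: cube_def)

lemma cube_Suc: "cube (Suc n) = (#) True ` cube n \<union> (#) False ` cube n"
  by (force simp: cube_def length_Suc_conv)

lemma finite_cube [simp]: "finite (cube n)"
  by (induction n) (auto simp: cube_0 cube_Suc)

lemma Cons_in_cube: "b # x \<in> cube (Suc n) \<longleftrightarrow> x \<in> cube n"
  by (simp add: cube_def)

lemma cube_mean_Suc:
  "cube_mean (Suc n) f = (cube_mean n (\<lambda>x. f (True # x)) + cube_mean n (\<lambda>x. f (False # x))) / 2"
proof -
  have "(\<Sum>x\<in>cube (Suc n). f x) = (\<Sum>x\<in>cube n. f (True # x)) + (\<Sum>x\<in>cube n. f (False # x))"
    unfolding cube_Suc by (subst sum.union_disjoint) (auto simp: sum.reindex)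
  then show ?thesis
    by (simp add: cube_mean_def field_simps)
qed

lemma cube_mean_mono: "(\<And>x. x \<in> cube n \<Longrightarrow> f x \<le> g x) \<Longrightarrow> cube_mean n f \<le> cube_mean n g"
  by (simp add: cube_mean_def divide_right_mono sum_mono)

lemma cube_mean_add: "cube_mean n (\<lambda>x. f x + g x) = cube_mean n f + cube_mean n g"
  by (simp add: cube_mean_def sum.distrib add_divide_distrib)

lemma cube_mean_diff: "cube_mean n (\<lambda>x. f x - g x) = cube_mean n f - cube_mean n g"
  by (simp add: cube_mean_def sum_subtractf diff_divide_distrib)

lemma cube_mean_cmult: "cube_mean n (\<lambda>x. c * f x) = c * cube_mean n f"
  by (simp add: cube_mean_def sum_distrib_left)

lemma cube_mean_const: "cube_mean n (\<lambda>x. c) = c"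
proof (induction n)
  case 0 then show ?case by (simp add: cube_mean_def cube_0)
next
  case (Suc n) then show ?case by (simp add: cube_mean_Suc)
qed

definition slice :: "bool \<Rightarrow> bool list set \<Rightarrow> bool list set" where
  "slice b A = {x. b # x \<in> A}"

lemma slice_subset: "A \<subseteq> cube (Suc n) \<Longrightarrow> slice b A \<subseteq> cube n"
  by (auto simp: slice_def Cons_in_cube dest!: subsetD)

lemma cube_density_slices:
  "cube_density (Suc n) A = (cube_density n (slice True A) + cube_density n (slice False A)) / 2"
proof -
  have "(\<lambda>x. indicat_real A (b # x)) = indicat_real (slice b A)" for b
    by (auto simp: fun_eq_iff slice_def indicator_def)
  then show ?thesis
    by (simp add: cube_density_def cube_mean_Suc)
qed

lemma cube_adj_Cons:
  assumes "x \<in> cube n" "y \<in> cube n"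
  shows "cube_adj (Suc n) (a # x) (b # y) \<longleftrightarrow> (if a = b then cube_adj n x y else x = y)"
proof -
  let ?D = "{i. i < n \<and> x ! i \<noteq> y ! i}"
  have "{i. i < Suc n \<and> (a # x) ! i \<noteq> (b # y) ! i} = (if a = b then {} else {0}) \<union> Suc ` ?D"
    by (auto simp: less_Suc_eq_0_disj)
  moreover have "card ((if a = b then {} else {0}) \<union> Suc ` ?D) = (if a = b then 0 else 1) + card ?D"
    by (subst card_Un_disjoint) (auto simp: card_image)
  moreover have "card ?D = 0 \<longleftrightarrow> x = y"
    using assms by (auto simp: cube_def intro: nth_equalityI)
  ultimately show ?thesis
    using assms by (auto simp: cube_adj_def Cons_in_cube)
qed

text \<open>
  Within its own half a vertex keeps the boundary edges of the corresponding slice; in the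
  remaining direction it has a single neighbour, which lies outside the set exactly when the
  vertex belongs to one slice only.
\<close>

lemma edge_bdry_Cons:
  assumes "x \<in> cube n"
  shows "edge_bdry (Suc n) A (b # x) =
    edge_bdry n (slice b A) x + (if x \<in> slice b A - slice (\<not> b) A then 1 else 0)"
proof (cases "b # x \<in> A")
  case False
  then show ?thesis by (simp add: edge_bdry_def slice_def)
next
  case True
  let ?N = "{y \<in> cube n - slice b A. cube_adj n x y}"
  let ?M = "if (\<not> b) # x \<in> A then {} else {(\<not> b) # x}"
  have mem: "b' # y \<in> {y \<in> cube (Suc n) - A. cube_adj (Suc n) (b # x) y} \<longleftrightarrow> b' # y \<in> (#) b ` ?N \<union> ?M"
    for b' y
    using assms by (cases "b' = b"; cases "y \<in> cube n")
      (auto simp: Cons_in_cube cube_adj_Cons slice_def)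
  have "{y \<in> cube (Suc n) - A. cube_adj (Suc n) (b # x) y} = (#) b ` ?N \<union> ?M"
  proof (rule set_eqI)
    fix z
    show "z \<in> {y \<in> cube (Suc n) - A. cube_adj (Suc n) (b # x) y} \<longleftrightarrow> z \<in> (#) b ` ?N \<union> ?M"
      using mem by (cases z) (auto simp: cube_def)
  qed
  moreover have "card ((#) b ` ?N \<union> ?M) = card ?N + card ?M"
    by (subst card_Un_disjoint) (auto simp: card_image)
  ultimately show ?thesis
    using True by (simp add: edge_bdry_def slice_def)
qed

definition root_mean :: "nat \<Rightarrow> bool list set \<Rightarrow> real" where
  "root_mean n A = cube_mean n (\<lambda>x. sqrt (real (edge_bdry n A x)))"

text \<open>
  This is the triangle inequality for the plane vectors with components \<open>indicat_real D x\<close> and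
  \<open>sqrt (h x)\<close>, whose lengths are \<open>sqrt (h x + indicat_real D x)\<close>.
\<close>

lemma cube_mean_sqrt_add_ge_norm:
  assumes h: "\<And>x. 0 \<le> h x"
  shows "sqrt ((cube_mean n (indicat_real D))\<^sup>2 + (cube_mean n (\<lambda>x. sqrt (h x)))\<^sup>2)
    \<le> cube_mean n (\<lambda>x. sqrt (h x + indicat_real D x))"
proof -
  let ?z = "\<lambda>x. Complex (indicat_real D x) (sqrt (h x))"
  have "Complex (\<Sum>x\<in>cube n. indicat_real D x) (\<Sum>x\<in>cube n. sqrt (h x)) = (\<Sum>x\<in>cube n. ?z x)"
    by (simp add: complex_eq_iff)
  then have "cmod (Complex (\<Sum>x\<in>cube n. indicat_real D x) (\<Sum>x\<in>cube n. sqrt (h x)))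
      \<le> (\<Sum>x\<in>cube n. cmod (?z x))"
    by (simp add: norm_sum)
  also have "(\<Sum>x\<in>cube n. cmod (?z x)) = (\<Sum>x\<in>cube n. sqrt (h x + indicat_real D x))"
    using h by (intro sum.cong) (auto simp: complex_norm indicator_def)
  finally have "sqrt ((\<Sum>x\<in>cube n. indicat_real D x)\<^sup>2 + (\<Sum>x\<in>cube n. sqrt (h x))\<^sup>2) / 2 ^ n
      \<le> cube_mean n (\<lambda>x. sqrt (h x + indicat_real D x))"
    by (simp add: complex_norm cube_mean_def divide_right_mono)
  also have "sqrt ((\<Sum>x\<in>cube n. indicat_real D x)\<^sup>2 + (\<Sum>x\<in>cube n. sqrt (h x))\<^sup>2) / 2 ^ n
     = sqrt ((cube_mean n (indicat_real D))\<^sup>2 + (cube_mean n (\<lambda>x. sqrt (h x)))\<^sup>2)"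
    unfolding cube_mean_def power_divide add_divide_distrib [symmetric] real_sqrt_divide
    by simp
  finally show ?thesis .
qed

text \<open>
  Equality holds for \<open>k = 0\<close> and \<open>k = 1\<close>.  Between these two values the inequality fails, so it
  is here that the number of boundary edges being an integer enters.
\<close>

lemma sqrt_Suc_ge: "1 + (sqrt 2 - 1) * sqrt (real k) \<le> sqrt (real k + 1)"
proof (cases "k = 0")
  case False
  let ?r = "sqrt (real k)"
  have r: "1 \<le> ?r" using False by simp
  have square: "(1 + c * r)\<^sup>2 = 1 + 2 * c * r + c\<^sup>2 * r\<^sup>2" for c r :: real
    by (simp add: power2_eq_square algebra_simps)
  have "(1 + (sqrt 2 - 1) * ?r)\<^sup>2 = 1 + 2 * (sqrt 2 - 1) * ?r + (sqrt 2 - 1)\<^sup>2 * ?r\<^sup>2"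
    by (rule square)
  also have "\<dots> \<le> 1 + 2 * (sqrt 2 - 1) * ?r\<^sup>2 + (sqrt 2 - 1)\<^sup>2 * ?r\<^sup>2"
    using r self_le_power[of ?r 2] by (simp add: mult_left_mono)
  also have "\<dots> = 1 + (2 * (sqrt 2 - 1) + (sqrt 2 - 1)\<^sup>2) * ?r\<^sup>2"
    by (simp add: ring_distribs)
  also have "2 * (sqrt 2 - 1) + (sqrt 2 - 1)\<^sup>2 = 1"
    by (simp add: power2_diff)
  finally have "(1 + (sqrt 2 - 1) * ?r)\<^sup>2 \<le> real k + 1"
    by simp
  then show ?thesis
    by (rule real_le_rsqrt)
qed simp

lemma cube_mean_sqrt_add_ge_linear:
  "cube_mean n (indicat_real D) + (sqrt 2 - 1) * cube_mean n (\<lambda>x. sqrt (real (k x)))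
    \<le> cube_mean n (\<lambda>x. sqrt (real (k x) + indicat_real D x))"
proof -
  have "indicat_real D x + (sqrt 2 - 1) * sqrt (real (k x)) \<le> sqrt (real (k x) + indicat_real D x)" for x
  proof (cases "x \<in> D")
    case True then show ?thesis using sqrt_Suc_ge[of "k x"] by simp
  next
    case False
    have "(sqrt 2 - 1) * sqrt (real (k x)) \<le> 1 * sqrt (real (k x))"
      using sqrt2_less_2 by (intro mult_right_mono) auto
    with False show ?thesis by simp
  qed
  then show ?thesis
    by (simp add: cube_mean_mono flip: cube_mean_add cube_mean_cmult)
qed

text \<open>
  A lower bound for the contribution of the denser half, when its slice has mean root boundary
  \<open>b\<close> and \<open>d\<close> is the proportion of its points that gain an edge towards the other half.  The first
  term is the better one for \<open>d \<le> b\<close>, the second one for \<open>b \<le> d\<close>; without the second term the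
  method could not reach the value \<open>0.4985\<close>.
\<close>

definition larger_slice_bound :: "real \<Rightarrow> real \<Rightarrow> real" where
  "larger_slice_bound d b = max (sqrt (d\<^sup>2 + b\<^sup>2)) (d + (sqrt 2 - 1) * b)"

lemma larger_slice_bound_mono:
  assumes "0 \<le> d" "d \<le> d'" "0 \<le> b" "b \<le> b'"
  shows "larger_slice_bound d b \<le> larger_slice_bound d' b'"
  unfolding larger_slice_bound_def using assms
  by (intro max.mono real_sqrt_le_mono add_mono power_mono mult_left_mono) auto

text \<open>
  Only the gain of edges in the denser half is used; the points that lie in the thinner slice
  alone are ignored.
\<close>

lemma root_mean_slices:
  assumes "cube_density n (slice (\<not> b) A) \<le> cube_density n (slice b A)"
  shows "root_mean n (slice (\<not> b) A) +
      larger_slice_bound (cube_density n (slice b A) - cube_density n (slice (\<not> b) A)) (root_mean n (slice b A))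
    \<le> 2 * root_mean (Suc n) A"
proof -
  let ?D = "slice b A - slice (\<not> b) A"
  have h: "cube_mean n (\<lambda>x. sqrt (edge_bdry (Suc n) A (b' # x)))
     = cube_mean n (\<lambda>x. sqrt (edge_bdry n (slice b' A) x + indicat_real (slice b' A - slice (\<not> b') A) x))" for b'
    unfolding cube_mean_def
    by (intro arg_cong2[of _ _ _ _ "(/)"] sum.cong) (auto simp: edge_bdry_Cons indicator_def)
  have "cube_density n (slice b A) - cube_density n (slice (\<not> b) A)
     = cube_mean n (\<lambda>x. indicat_real (slice b A) x - indicat_real (slice (\<not> b) A) x)"
    by (simp add: cube_density_def cube_mean_diff)
  also have "\<dots> \<le> cube_mean n (indicat_real ?D)"
    by (rule cube_mean_mono) (auto simp: indicator_def)
  finally have D: "cube_density n (slice b A) - cube_density n (slice (\<not> b) A) \<le> cube_mean n (indicat_real ?D)" .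
  have nonneg: "0 \<le> root_mean n (slice b A)"
    by (simp add: root_mean_def cube_mean_def sum_nonneg)
  have "larger_slice_bound (cube_density n (slice b A) - cube_density n (slice (\<not> b) A)) (root_mean n (slice b A))
      \<le> larger_slice_bound (cube_mean n (indicat_real ?D)) (root_mean n (slice b A))"
    using assms D nonneg by (intro larger_slice_bound_mono) auto
  also have "\<dots> \<le> cube_mean n (\<lambda>x. sqrt (edge_bdry (Suc n) A (b # x)))"
    unfolding h larger_slice_bound_def root_mean_def
    using cube_mean_sqrt_add_ge_norm[of "\<lambda>x. real (edge_bdry n (slice b A) x)" n ?D]
      cube_mean_sqrt_add_ge_linear[of n ?D "edge_bdry n (slice b A)"] by simp
  finally have big: "larger_slice_bound (cube_density n (slice b A) - cube_density n (slice (\<not> b) A)) (root_mean n (slice b A))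
      \<le> cube_mean n (\<lambda>x. sqrt (edge_bdry (Suc n) A (b # x)))" .
  have small: "root_mean n (slice (\<not> b) A) \<le> cube_mean n (\<lambda>x. sqrt (edge_bdry (Suc n) A ((\<not> b) # x)))"
    unfolding h root_mean_def by (intro cube_mean_mono) auto
  have "2 * root_mean (Suc n) A = cube_mean n (\<lambda>x. sqrt (edge_bdry (Suc n) A (b # x)))
      + cube_mean n (\<lambda>x. sqrt (edge_bdry (Suc n) A ((\<not> b) # x)))"
    unfolding root_mean_def cube_mean_Suc by (cases b) auto
  with big small show ?thesis by linarith
qed

text \<open>
  The inequality that lets \<open>B\<close> pass from the two slices, with densities \<open>x \<le> y\<close>, to the whole set.
\<close>

definition two_point :: "(real \<Rightarrow> real) \<Rightarrow> real \<Rightarrow> real \<Rightarrow> bool" where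
  "two_point B x y \<longleftrightarrow> 2 * B ((x + y) / 2) \<le> B x + larger_slice_bound (y - x) (B y)"

lemma cube_density_bounds: "0 \<le> cube_density n A" "cube_density n A \<le> 1"
proof -
  show "0 \<le> cube_density n A"
    by (simp add: cube_density_def cube_mean_def sum_nonneg)
  have "cube_density n A \<le> cube_mean n (\<lambda>_. 1)"
    unfolding cube_density_def by (rule cube_mean_mono) (simp add: indicator_def)
  then show "cube_density n A \<le> 1" by (simp add: cube_mean_const)
qed

text \<open>
  The Bellman function principle: by induction on the dimension, every function with the
  two-point property is a lower bound for the mean root boundary at a given density.
\<close>

lemma two_point_induction:
  assumes B: "B 0 \<le> 0" "B 1 \<le> 0" "\<And>x. 0 \<le> x \<Longrightarrow> x \<le> 1 \<Longrightarrow> 0 \<le> B x"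
    and two_point: "\<And>x y. 0 \<le> x \<Longrightarrow> x \<le> y \<Longrightarrow> y \<le> 1 \<Longrightarrow> two_point B x y"
    and "A \<subseteq> cube n"
  shows "B (cube_density n A) \<le> root_mean n A"
  using \<open>A \<subseteq> cube n\<close>
proof (induction n arbitrary: A)
  case 0
  have "0 \<le> root_mean 0 A"
    by (simp add: root_mean_def cube_mean_def sum_nonneg)
  moreover have "cube_density 0 A = 0 \<or> cube_density 0 A = 1"
    by (auto simp: cube_density_def cube_mean_def cube_0 indicator_def)
  ultimately show ?case using B by force
next
  case (Suc n)
  obtain b where b: "cube_density n (slice (\<not> b) A) \<le> cube_density n (slice b A)"
  proof (cases "cube_density n (slice False A) \<le> cube_density n (slice True A)")
    case True then show ?thesis using that[of True] by simp
  next
    case False then show ?thesis using that[of False] by simp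
  qed
  let ?x = "cube_density n (slice (\<not> b) A)" and ?y = "cube_density n (slice b A)"
  have mid: "cube_density (Suc n) A = (?x + ?y) / 2"
    unfolding cube_density_slices by (cases b) auto
  have IH: "B ?x \<le> root_mean n (slice (\<not> b) A)" "B ?y \<le> root_mean n (slice b A)"
    using Suc.prems by (auto intro!: Suc.IH slice_subset)
  have "2 * B ((?x + ?y) / 2) \<le> B ?x + larger_slice_bound (?y - ?x) (B ?y)"
    using two_point[of ?x ?y] b cube_density_bounds by (simp add: two_point_def)
  also have "\<dots> \<le> root_mean n (slice (\<not> b) A) + larger_slice_bound (?y - ?x) (root_mean n (slice b A))"
    using IH b B(3) cube_density_bounds by (intro add_mono larger_slice_bound_mono) auto
  also have "\<dots> \<le> 2 * root_mean (Suc n) A"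
    by (rule root_mean_slices[OF b])
  finally show ?case by (simp add: mid)
qed

lemma iso_profile_half_ge:
  assumes "\<And>n A. A \<subseteq> cube n \<Longrightarrow> cube_density n A = x \<Longrightarrow> c \<le> root_mean n A"
  shows "ereal c \<le> iso_profile (1/2) x"
  unfolding iso_profile_def
  by (intro INF_greatest) (use assms in \<open>auto simp: powr_half_sqrt root_mean_def\<close>)

lemma edge_bdry_singleton: "edge_bdry k {replicate k True} (replicate k True) = k"
proof (induction k)
  case 0
  then show ?case by (simp add: edge_bdry_def cube_0)
next
  case (Suc k)
  have "slice True {replicate (Suc k) True} = {replicate k True}"
    "slice False {replicate (Suc k) True} = {}"
    by (auto simp: slice_def)
  then show ?case
    using Suc edge_bdry_Cons[of "replicate k True" k "{replicate (Suc k) True}" True]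
    by (simp add: cube_def)
qed

lemma cube_mean_only:
  assumes "z \<in> cube n" "\<And>x. x \<in> cube n \<Longrightarrow> x \<noteq> z \<Longrightarrow> f x = 0"
  shows "cube_mean n f = f z / 2 ^ n"
proof -
  have "sum f (cube n) = sum f {z}"
    using assms by (intro sum.mono_neutral_right) auto
  then show ?thesis by (simp add: cube_mean_def)
qed

lemma iso_profile_subcube_le:
  assumes "k \<ge> 1"
  shows "iso_profile (1/2) (1 / 2 ^ k) \<le> ereal (1 / 2 ^ k * sqrt (real k))"
proof -
  let ?z = "replicate k True"
  have z: "?z \<in> cube k" by (simp add: cube_def)
  have d: "cube_density k {?z} = 1 / 2 ^ k"
    unfolding cube_density_def using cube_mean_only[OF z, of "indicat_real {?z}"] by simp
  have m: "cube_mean k (\<lambda>y. real (edge_bdry k {?z} y) powr (1/2)) = 1 / 2 ^ k * sqrt (real k)"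
    using cube_mean_only[OF z, of "\<lambda>y. real (edge_bdry k {?z} y) powr (1/2)"]
    by (simp add: edge_bdry_singleton powr_half_sqrt) (simp add: edge_bdry_def)
  show ?thesis
    unfolding iso_profile_def
    by (rule INF_lower2[of k], use assms in simp, rule INF_lower2[of "{?z}"])
       (use z d m in auto)
qed

section \<open>The profile of subcubes at small densities\<close>

text \<open>
  This bound and the next one agree with the logarithm to second order at \<open>1\<close>.  For the lower
  bound this precision is needed, because the inequality for \<open>ell\<close> below degenerates to second order
  as its two arguments approach each other.
\<close>

lemma ln_ge_rational:
  fixes r :: real assumes "1 \<le> r" shows "2 * (r - 1) / (r + 1) \<le> ln r"
proof -
  have "ln 1 - 2 * (1 - 1) / (1 + 1) \<le> ln r - 2 * (r - 1) / (r + 1)"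
  proof (rule DERIV_nonneg_imp_nondecreasing[OF assms])
    fix x :: real assume x: "1 \<le> x" "x \<le> r"
    have "((\<lambda>x. ln x - 2 * (x - 1) / (x + 1)) has_real_derivative
        1 / x - (2 * (x + 1) - 2 * (x - 1)) / (x + 1)\<^sup>2) (at x)"
      using x by (auto intro!: derivative_eq_intros simp: power2_eq_square)
    moreover have "1 / x - (2 * (x + 1) - 2 * (x - 1)) / (x + 1)\<^sup>2 = (x - 1)\<^sup>2 / (x * (x + 1)\<^sup>2)"
      using x by (simp add: divide_simps) (simp add: power2_eq_square algebra_simps)
    ultimately show "\<exists>y. ((\<lambda>x. ln x - 2 * (x - 1) / (x + 1)) has_real_derivative y) (at x) \<and> 0 \<le> y"
      using x by (metis (no_types, lifting) divide_nonneg_nonneg mult_nonneg_nonneg order_trans zero_le_one zero_le_power2)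
  qed
  then show ?thesis by simp
qed

lemma ln_le_rational:
  fixes r :: real assumes "1 \<le> r" shows "ln r \<le> (r - 1 / r) / 2"
proof -
  have "(1 - 1 / 1) / 2 - ln 1 \<le> (r - 1 / r) / 2 - ln r"
  proof (rule DERIV_nonneg_imp_nondecreasing[OF assms])
    fix x :: real assume x: "1 \<le> x" "x \<le> r"
    have "((\<lambda>x. (x - 1 / x) / 2 - ln x) has_real_derivative (1 + 1 / x\<^sup>2) / 2 - 1 / x) (at x)"
      using x by (auto intro!: derivative_eq_intros simp: power2_eq_square field_simps)
    moreover have "(1 + 1 / x\<^sup>2) / 2 - 1 / x = (1 - 1 / x)\<^sup>2 / 2"
      by (simp add: power2_eq_square algebra_simps)
    ultimately show "\<exists>y. ((\<lambda>x. (x - 1 / x) / 2 - ln x) has_real_derivative y) (at x) \<and> 0 \<le> y"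
      by (metis divide_nonneg_nonneg zero_le_numeral zero_le_power2)
  qed
  then show ?thesis by simp
qed

lemma log2_ge_rational: "1 \<le> r \<Longrightarrow> 72 / 25 * ((r - 1) / (r + 1)) \<le> log 2 r"
proof -
  assume r: "1 \<le> r"
  have "0 < ln (2::real)" by simp
  have "72 / 25 * ((r - 1) / (r + 1)) * ln 2 \<le> 72 / 25 * ((r - 1) / (r + 1)) * (25 / 36)"
    using r ln2_le_25_over_36 by (intro mult_left_mono) auto
  also have "\<dots> = 2 * (r - 1) / (r + 1)"
    using r by (simp add: divide_simps) (simp add: algebra_simps)
  also have "\<dots> \<le> ln r"
    by (rule ln_ge_rational[OF r])
  finally show ?thesis by (simp add: log_def field_simps)
qed

lemma log2_le_rational: "1 \<le> r \<Longrightarrow> log 2 r \<le> 3 / 4 * (r - 1 / r)"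
proof -
  assume r: "1 \<le> r"
  have "1 / r \<le> 1" using r by simp
  with r have "1 / r \<le> r" by linarith
  then have "(r - 1 / r) / 2 \<le> 3 / 4 * (r - 1 / r) * ln 2"
    using mult_left_mono[OF ln2_ge_two_thirds, of "3 / 4 * (r - 1 / r)"] by simp
  with ln_le_rational[OF r] have "ln r \<le> 3 / 4 * (r - 1 / r) * ln 2" by linarith
  then show ?thesis by (simp add: log_def field_simps)
qed

text \<open>
  This is the derivative of the binary logarithm at \<open>2\<close>.
\<close>

definition half_rate :: real where "half_rate = 1 / (2 * ln 2)"

lemma half_rate_bounds: "0 < half_rate" "half_rate \<le> 3 / 4"
  using ln2_ge_two_thirds by (simp_all add: half_rate_def field_simps)

lemma ln2_bounds_strict: "1 / 2 < ln (2 :: real)" "ln (2 :: real) < 3 / 4"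
  using ln2_ge_two_thirds ln2_le_25_over_36 by auto

text \<open>
  The two sides agree at \<open>0\<close>, and at \<open>1\<close> they agree together with their derivatives.  The derivative
  of the difference has the factor \<open>1 - t\<close>; the other factor is linear in \<open>t\<close> and changes its sign
  only at the point \<open>s\<close>, so that the difference first increases from \<open>0\<close> and then decreases to \<open>0\<close>.
\<close>

lemma ln_one_plus_ge_quadratic:
  fixes t :: real assumes "0 \<le> t" "t \<le> 1"
  shows "ln 2 * (2 * t - t\<^sup>2) - t * (1 - t) / 2 \<le> ln (1 + t)"
proof -
  define a where "a = 2 * ln (2 :: real)"
  define f :: "real \<Rightarrow> real" where "f = (\<lambda>t. ln (1 + t) - ln 2 * (2 * t - t\<^sup>2) + t * (1 - t) / 2)"
  define s where "s = (3 / 2 - a) / (a - 1)"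
  have a: "1 < a" "a < 3 / 2" using ln2_bounds_strict by (auto simp: a_def)
  have f': "(f has_real_derivative (1 - t) * ((3 / 2 - a) - (a - 1) * t) / (1 + t)) (at t)" if "0 \<le> t" for t
    unfolding f_def a_def using that
    by (auto intro!: derivative_eq_intros simp: field_simps power2_eq_square)
  have sign: "0 \<le> (3 / 2 - a) - (a - 1) * t \<longleftrightarrow> t \<le> s" for t
    using a by (simp add: s_def field_simps)
  have "0 \<le> s" using a by (simp add: s_def)
  have "f 0 = 0" "f 1 = 0" by (simp_all add: f_def)
  have "0 \<le> f t"
  proof (cases "t \<le> s")
    case True
    have "f 0 \<le> f t"
    proof (rule DERIV_nonneg_imp_nondecreasing[OF assms(1)])
      fix x assume x: "0 \<le> x" "x \<le> t"
      then have "0 \<le> (1 - x) * ((3 / 2 - a) - (a - 1) * x) / (1 + x)"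
        using sign[of x] True assms by (intro divide_nonneg_nonneg mult_nonneg_nonneg) auto
      with f'[of x] x show "\<exists>y. (f has_real_derivative y) (at x) \<and> 0 \<le> y" by blast
    qed
    then show ?thesis by (simp add: \<open>f 0 = 0\<close>)
  next
    case False
    have "f 1 \<le> f t"
    proof (rule DERIV_nonpos_imp_nonincreasing[OF assms(2)])
      fix x assume x: "t \<le> x" "x \<le> 1"
      then have "(1 - x) * ((3 / 2 - a) - (a - 1) * x) / (1 + x) \<le> 0"
        using sign[of x] False assms by (intro divide_nonpos_nonneg mult_nonneg_nonpos) auto
      with f'[of x] x assms show "\<exists>y. (f has_real_derivative y) (at x) \<and> y \<le> 0" by force
    qed
    then show ?thesis by (simp add: \<open>f 1 = 0\<close>)
  qed
  then show ?thesis by (simp add: f_def)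
qed

lemma log2_one_plus_ge:
  assumes "0 \<le> t" "t \<le> 1"
  shows "2 * t - t\<^sup>2 - half_rate * (t * (1 - t)) \<le> log 2 (1 + t)"
  using divide_right_mono[OF ln_one_plus_ge_quadratic[OF assms], of "ln 2"]
  by (simp add: half_rate_def log_def diff_divide_distrib)

lemma log2_mid_ge:
  assumes "0 < t" "t \<le> 1"
  shows "4 * half_rate * (1 - t) / (1 + 3 * t) \<le> log 2 ((1 + t) / (2 * t))"
proof -
  have "(1 + t) / (2 * t) - 1 = (1 - t) / (2 * t)" "(1 + t) / (2 * t) + 1 = (1 + 3 * t) / (2 * t)"
    using assms by (auto simp: field_simps)
  moreover have "1 \<le> (1 + t) / (2 * t)"
    using assms by simp
  ultimately have "2 * (1 - t) / (1 + 3 * t) \<le> ln ((1 + t) / (2 * t))"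
    using ln_ge_rational[of "(1 + t) / (2 * t)"] assms by simp
  from divide_right_mono[OF this, of "ln 2"] show ?thesis
    by (simp add: half_rate_def log_def mult.commute)
qed

lemma sqrt_one_plus_ge: assumes "0 \<le> w" shows "1 + 2 * w / (4 + w) \<le> sqrt (1 + w)"
proof (rule real_le_rsqrt)
  have "0 \<le> w ^ 3 / (4 + w)\<^sup>2" using assms by simp
  also have "w ^ 3 / (4 + w)\<^sup>2 = 1 + w - (1 + 2 * w / (4 + w))\<^sup>2"
    using assms by (simp add: divide_simps) (simp add: algebra_simps power_numeral_reduce)
  finally show "(1 + 2 * w / (4 + w))\<^sup>2 \<le> 1 + w" by simp
qed

lemma sqrt_one_minus_ge: assumes "0 \<le> z" "z \<le> 1" shows "1 - z / 2 - z\<^sup>2 / 2 \<le> sqrt (1 - z)"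
proof (rule real_le_rsqrt)
  have "0 \<le> (1 - z) * z\<^sup>2 * (3 + z) / 4" using assms by simp
  also have "(1 - z) * z\<^sup>2 * (3 + z) / 4 = (1 - z) - (1 - z / 2 - z\<^sup>2 / 2)\<^sup>2"
    by (simp add: field_simps power_numeral_reduce)
  finally show "(1 - z / 2 - z\<^sup>2 / 2)\<^sup>2 \<le> 1 - z" by simp
qed

text \<open>
  After division by \<open>y\<close>, the two-point inequality for \<open>ell\<close> at a pair \<open>x = t * y\<close> takes this shape, where
  \<open>G\<close> is the binary logarithm of the inverse of the midpoint.  The bounds for \<open>sqrt (1 + w)\<close> and
  \<open>sqrt (1 - z)\<close> turn it into a polynomial inequality that has the factor \<open>1 - t\<close>, and what
  remains holds with room to spare as soon as \<open>2 \<le> G\<close>.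
\<close>

lemma sqrt_balance:
  fixes \<mu> t G :: real
  assumes "0 \<le> \<mu>" "\<mu> \<le> 3 / 4" "0 \<le> t" "t \<le> 1" "2 \<le> G"
  defines "\<delta> \<equiv> \<mu> * (t * (1 - t))" and "\<eta> \<equiv> 4 * \<mu> * (1 - t) / (1 + 3 * t)"
  shows "(1 + t) * sqrt G \<le> t * sqrt (G + \<eta>) + sqrt (G - \<delta>)"
proof -
  have t1: "t * (1 - t) \<le> 1" "0 \<le> t * (1 - t)"
    using assms mult_mono[of t 1 "1 - t" 1] by auto
  have \<delta>: "0 \<le> \<delta>" "\<delta> \<le> 3 / 4"
    using assms t1 mult_mono[of \<mu> "3 / 4" "t * (1 - t)" 1] by (auto simp: \<delta>_def)
  have \<eta>: "0 \<le> \<eta>" using assms by (simp add: \<eta>_def)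
  have G: "0 < G" using assms by simp
  have "\<mu> * (1 + t + 3 * t\<^sup>2) \<le> 3 / 4 * 5"
    using assms power_le_one[of t 2] by (intro mult_mono) auto
  then have "G * (\<mu> * (1 + t + 3 * t\<^sup>2)) \<le> 15 / 4 * G"
    using mult_left_mono[of "\<mu> * (1 + t + 3 * t\<^sup>2)" "15 / 4" G] G by simp
  moreover have "\<mu>\<^sup>2 * (t * (1 - t)) \<le> (3 / 4)\<^sup>2 * 1"
    using assms t1 by (intro mult_mono power_mono) auto
  then have "\<mu>\<^sup>2 * (t * (1 - t)) \<le> 9 / 16"
    by (simp add: power2_eq_square)
  moreover have "2 * G \<le> G\<^sup>2"
    using mult_right_mono[OF assms(5), of G] G by (simp add: power2_eq_square)
  ultimately have "G * (\<mu> * (1 + t + 3 * t\<^sup>2)) + \<mu>\<^sup>2 * (t * (1 - t)) \<le> 3 * G\<^sup>2"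
    using assms(5) by linarith
  then have "0 \<le> (3 * G\<^sup>2 - G * (\<mu> * (1 + t + 3 * t\<^sup>2)) - \<mu>\<^sup>2 * (t * (1 - t))) * (1 - t) * (\<mu> * (t * (1 - t)))"
    using assms t1 by (intro mult_nonneg_nonneg) auto
  also have "\<dots> = \<mu> * (t * (1 - t)) * (4 * G\<^sup>2 - (G + \<delta>) * (G * (1 + 3 * t) + \<mu> * (1 - t)))"
    unfolding \<delta>_def by (simp add: algebra_simps power_numeral_reduce)
  also have "\<dots> = (4 * t * \<eta> * G\<^sup>2 - \<delta> * (G + \<delta>) * (4 * G + \<eta>)) * (1 + 3 * t) / 4"
  proof -
    have e: "\<eta> * (1 + 3 * t) = 4 * \<mu> * (1 - t)"
      using assms by (simp add: \<eta>_def)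
    have dist: "(4 * t * e * G\<^sup>2 - d * (G + d) * (4 * G + e)) * p / 4
      = t * (e * p) * G\<^sup>2 - d * (G + d) * (G * p + e * p / 4)" for d e p :: real
      by (simp add: field_simps)
    show ?thesis unfolding dist e \<delta>_def by (simp add: field_simps power2_eq_square)
  qed
  finally have main: "\<delta> * (G + \<delta>) * (4 * G + \<eta>) \<le> 4 * t * \<eta> * G\<^sup>2"
    using assms by (simp add: zero_le_mult_iff)
  have frac: "\<delta> / (2 * G) + \<delta>\<^sup>2 / (2 * G\<^sup>2) \<le> t * (2 * \<eta> / (4 * G + \<eta>))"
  proof -
    have "\<delta> / (2 * G) + \<delta>\<^sup>2 / (2 * G\<^sup>2) = \<delta> * (G + \<delta>) / (2 * G\<^sup>2)"
      using G by (simp add: field_simps power2_eq_square)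
    also have "\<dots> \<le> 2 * t * \<eta> / (4 * G + \<eta>)"
      using main G \<eta> by (simp add: divide_simps)
    finally show ?thesis by simp
  qed
  have "(1 + t) * sqrt G \<le> t * (sqrt G * (1 + 2 * (\<eta> / G) / (4 + \<eta> / G)))
      + sqrt G * (1 - \<delta> / G / 2 - (\<delta> / G)\<^sup>2 / 2)"
  proof -
    have e1: "2 * (\<eta> / G) / (4 + \<eta> / G) = 2 * \<eta> / (4 * G + \<eta>)"
      using G \<eta> by (simp add: field_simps)
    have e2: "\<delta> / G / 2 + (\<delta> / G)\<^sup>2 / 2 = \<delta> / (2 * G) + \<delta>\<^sup>2 / (2 * G\<^sup>2)"
      by (simp add: power_divide)
    have "0 \<le> sqrt G * (t * (2 * (\<eta> / G) / (4 + \<eta> / G)) - (\<delta> / G / 2 + (\<delta> / G)\<^sup>2 / 2))"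
      unfolding e1 e2 using frac G by (intro mult_nonneg_nonneg) auto
    then show ?thesis by (simp add: algebra_simps)
  qed
  also have "\<dots> \<le> t * (sqrt G * sqrt (1 + \<eta> / G)) + sqrt G * sqrt (1 - \<delta> / G)"
    using G \<delta> \<eta> assms
    by (intro add_mono mult_left_mono sqrt_one_plus_ge sqrt_one_minus_ge) (auto simp: field_simps)
  also have "\<dots> = t * sqrt (G + \<eta>) + sqrt (G - \<delta>)"
    using G by (simp add: distrib_left right_diff_distrib flip: real_sqrt_mult)
  finally show ?thesis .
qed

text \<open>
  A subcube of codimension \<open>k\<close> has density \<open>x = 1 / 2 ^ k\<close> and mean root boundary
  \<open>sqrt (real k) / 2 ^ k = ell x\<close>.  At the left end \<open>ell 0 = 0\<close>, since \<open>1 / 0 = 0\<close> and the logarithm of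
  \<open>0\<close> is \<open>0\<close>.
\<close>

definition ell :: "real \<Rightarrow> real" where
  "ell x = x * sqrt (log 2 (1 / x))"

text \<open>
  For \<open>x = 0\<close> there is equality, which reflects that halving a subcube gives a subcube.  The
  restriction of the midpoint is essential for the proof: it says that \<open>2 \<le> G\<close> below.
\<close>

lemma ell_two_point:
  assumes "0 \<le> x" "x \<le> y" "(x + y) / 2 \<le> 1 / 4"
  shows "2 * ell ((x + y) / 2) \<le> ell x + sqrt ((y - x)\<^sup>2 + (ell y)\<^sup>2)"
proof (cases "x = 0")
  case True
  show ?thesis
  proof (cases "y = 0")
    case False
    with True assms have y: "0 < y" "y \<le> 1 / 2" by auto
    have "0 \<le> log 2 (1 / y)" using y by (simp add: field_simps)
    have "log 2 (2 / y) = 1 + log 2 (1 / y)"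
      using y by (simp add: log_divide)
    then have "2 * ell (y / 2) = sqrt (y\<^sup>2 * (1 + log 2 (1 / y)))"
      using y by (simp add: ell_def real_sqrt_mult)
    also have "\<dots> = sqrt (y\<^sup>2 + (ell y)\<^sup>2)"
      using \<open>0 \<le> log 2 (1 / y)\<close> by (simp add: ell_def power_mult_distrib distrib_left)
    finally show ?thesis using True by (simp add: ell_def)
  qed (use True in \<open>simp add: ell_def\<close>)
next
  case False
  define t where "t = x / y"
  define G where "G = log 2 (2 / (x + y))"
  define \<delta> where "\<delta> = half_rate * (t * (1 - t))"
  define \<eta> where "\<eta> = 4 * half_rate * (1 - t) / (1 + 3 * t)"
  have pos: "0 < x" "0 < y" using False assms by auto
  have t: "0 < t" "t \<le> 1" "x = t * y" using pos assms by (auto simp: t_def)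
  have "log 2 4 \<le> G"
    unfolding G_def using pos assms by (subst log_le_cancel_iff) (auto simp: field_simps)
  moreover have "log 2 (4 :: real) = 2"
    using log_pow_cancel[of 2 2] by simp
  ultimately have G: "2 \<le> G" by simp
  have "0 < x + y" using pos by simp
  have inv: "1 / x = 2 / (x + y) * ((1 + t) / (2 * t))" "1 / y = 2 / (x + y) * ((1 + t) / 2)"
    using \<open>0 < x + y\<close> pos by (simp_all add: t_def divide_simps)
  have gx: "log 2 (1 / x) = G + log 2 ((1 + t) / (2 * t))"
    unfolding G_def inv(1) using \<open>0 < x + y\<close> t(1) by (intro log_mult_pos) auto
  have gy: "log 2 (1 / y) = G + log 2 ((1 + t) / 2)"
    unfolding G_def inv(2) using \<open>0 < x + y\<close> t(1) by (intro log_mult_pos) auto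
  have "log 2 ((1 + t) / 2) = log 2 (1 + t) - 1"
    using t by (simp add: log_divide)
  with gy have gy: "log 2 (1 / y) = G - 1 + log 2 (1 + t)" by simp
  \<comment> \<open>The quantities under the square roots of \<open>sqrt_balance\<close> are bounded by the true ones.\<close>
  have rad: "G - \<delta> \<le> (1 - t)\<^sup>2 + log 2 (1 / y)"
    using log2_one_plus_ge[of t] t unfolding gy \<delta>_def by (simp add: power2_eq_square algebra_simps)
  have "0 \<le> log 2 (1 / y)" using pos assms by (simp add: field_simps)
  have "2 * ell ((x + y) / 2) = y * ((1 + t) * sqrt G)"
    by (simp add: ell_def G_def t(3) algebra_simps)
  also have "\<dots> \<le> y * (t * sqrt (G + \<eta>) + sqrt (G - \<delta>))"
    unfolding \<delta>_def \<eta>_def using pos t G half_rate_bounds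
    by (intro mult_left_mono sqrt_balance) auto
  also have "\<dots> \<le> y * (t * sqrt (log 2 (1 / x)) + sqrt ((1 - t)\<^sup>2 + log 2 (1 / y)))"
    using rad pos t log2_mid_ge[of t] unfolding gx \<eta>_def
    by (intro mult_left_mono add_mono real_sqrt_le_mono) auto
  also have "\<dots> = ell x + sqrt (y\<^sup>2 * ((1 - t)\<^sup>2 + log 2 (1 / y)))"
    using pos by (simp only: ell_def t(3) real_sqrt_mult) (simp add: distrib_left)
  also have "y\<^sup>2 * ((1 - t)\<^sup>2 + log 2 (1 / y)) = (y - x)\<^sup>2 + (ell y)\<^sup>2"
    using \<open>0 \<le> log 2 (1 / y)\<close> by (simp add: ell_def t(3) power2_eq_square algebra_simps)
  finally show ?thesis .
qed

section \<open>Nonnegativity of polynomials on boxes\<close>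

text \<open>
  A polynomial in one variable is the list of its coefficients in increasing order, and a
  polynomial in two variables \<open>x\<close>, \<open>y\<close> is the list of its coefficients with respect to \<open>x\<close>, which are
  polynomials in \<open>y\<close>.
\<close>

fun eval1 :: "real list \<Rightarrow> real \<Rightarrow> real" where
  "eval1 [] y = 0"
| "eval1 (c # cs) y = c + y * eval1 cs y"

fun eval2 :: "real list list \<Rightarrow> real \<Rightarrow> real \<Rightarrow> real" where
  "eval2 [] x y = 0"
| "eval2 (r # rs) x y = eval1 r y + x * eval2 rs x y"

text \<open>
  Horner evaluation with intervals on a box that has a corner at the origin: each partial result is
  multiplied by a variable that ranges over \<open>{0..b}\<close>, so a negative lower bound is multiplied by
  \<open>b\<close> and a positive one has to be replaced by \<open>0\<close>.
\<close>

fun low1 :: "real list \<Rightarrow> real \<Rightarrow> real" where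
  "low1 [] b = 0"
| "low1 (c # cs) b = c + min 0 (b * low1 cs b)"

fun low2 :: "real list list \<Rightarrow> real \<Rightarrow> real \<Rightarrow> real" where
  "low2 [] a b = 0"
| "low2 (r # rs) a b = low1 r b + min 0 (a * low2 rs a b)"

fun add1 :: "real list \<Rightarrow> real list \<Rightarrow> real list" where
  "add1 [] ds = ds"
| "add1 cs [] = cs"
| "add1 (c # cs) (d # ds) = (c + d) # add1 cs ds"

text \<open>
  The coefficients of \<open>c + (x + t) * q x\<close>; one step of the expansion around a new origin.  The
  list \<open>q\<close> is traversed once, which keeps the evaluation of \<open>shift1\<close> by rewriting quadratic.
\<close>

fun shift1_step :: "real \<Rightarrow> real \<Rightarrow> real list \<Rightarrow> real list" where
  "shift1_step t c [] = [c]"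
| "shift1_step t c (d # ds) = (c + t * d) # shift1_step t d ds"

fun shift1 :: "real \<Rightarrow> real list \<Rightarrow> real list" where
  "shift1 t [] = []"
| "shift1 t (c # cs) = shift1_step t c (shift1 t cs)"

fun shift2_step :: "real \<Rightarrow> real list \<Rightarrow> real list list \<Rightarrow> real list list" where
  "shift2_step t r [] = [r]"
| "shift2_step t r (q # qs) = add1 r (map ((*) t) q) # shift2_step t q qs"

fun shift2 :: "real \<Rightarrow> real list list \<Rightarrow> real list list" where
  "shift2 t [] = []"
| "shift2 t (r # rs) = shift2_step t r (shift2 t rs)"

text \<open>
  A certificate of nonnegativity on the box \<open>{0..a} \<times> {0..b}\<close> is a plan for bisecting the box
  until the Horner bound is nonnegative on every part.  After each bisection the polynomial is
  expanded around the new corner, so that the error of the bound is quadratic in the size of a part.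
\<close>

datatype subdiv = Box | SplitX subdiv subdiv | SplitY subdiv subdiv

fun certifies :: "subdiv \<Rightarrow> real list list \<Rightarrow> real \<Rightarrow> real \<Rightarrow> bool" where
  "certifies Box p a b \<longleftrightarrow> 0 \<le> low2 p a b"
| "certifies (SplitX l r) p a b \<longleftrightarrow>
     certifies l p (a / 2) b \<and> certifies r (shift2 (a / 2) p) (a / 2) b"
| "certifies (SplitY l r) p a b \<longleftrightarrow>
     certifies l p a (b / 2) \<and> certifies r (map (shift1 (b / 2)) p) a (b / 2)"

lemma min_mult_le:
  fixes a x l v :: real assumes "0 \<le> x" "x \<le> a" "l \<le> v" shows "min 0 (a * l) \<le> x * v"
proof (cases "0 \<le> l")
  case True with assms show ?thesis by (simp add: min.coboundedI1)
next
  case False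
  have "a * l \<le> x * l" using assms False by (simp add: mult_right_mono_neg)
  also have "\<dots> \<le> x * v" using assms by (simp add: mult_left_mono)
  finally show ?thesis by (simp add: min.coboundedI2)
qed

lemma low1_le: "0 \<le> y \<Longrightarrow> y \<le> b \<Longrightarrow> low1 cs b \<le> eval1 cs y"
  by (induction cs) (auto intro!: min_mult_le)

lemma low2_le:
  assumes "0 \<le> x" "x \<le> a" "0 \<le> y" "y \<le> b"
  shows "low2 p a b \<le> eval2 p x y"
  using assms by (induction p) (auto intro!: add_mono low1_le min_mult_le)

lemma eval1_add1: "eval1 (add1 p q) y = eval1 p y + eval1 q y"
  by (induction p q rule: add1.induct) (auto simp: algebra_simps)

lemma eval1_scale: "eval1 (map ((*) t) p) y = t * eval1 p y"
  by (induction p) (auto simp: algebra_simps)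

lemma eval1_shift1_step: "eval1 (shift1_step t c q) y = c + (y + t) * eval1 q y"
  by (induction t c q rule: shift1_step.induct) (simp_all add: algebra_simps)

lemma eval1_shift1: "eval1 (shift1 t p) y = eval1 p (y + t)"
  by (induction p) (simp_all add: eval1_shift1_step)

lemma eval2_shift2_step: "eval2 (shift2_step t r q) x y = eval1 r y + (x + t) * eval2 q x y"
  by (induction t r q rule: shift2_step.induct)
     (simp_all add: eval1_add1 eval1_scale ring_distribs)

lemma eval2_shift2: "eval2 (shift2 t p) x y = eval2 p (x + t) y"
  by (induction p) (simp_all add: eval2_shift2_step)

lemma eval2_shift1: "eval2 (map (shift1 t) p) x y = eval2 p x (y + t)"
  by (induction p) (simp_all add: eval1_shift1)

lemma certifies_nonneg:
  assumes "certifies s p a b" "0 \<le> x" "x \<le> a" "0 \<le> y" "y \<le> b"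
  shows "0 \<le> eval2 p x y"
  using assms
proof (induction s arbitrary: p a b x y)
  case Box
  then show ?case using low2_le[of x a y b p] by simp
next
  case (SplitX l r)
  show ?case
  proof (cases "x \<le> a / 2")
    case True
    then show ?thesis using SplitX by auto
  next
    case False
    then show ?thesis
      using SplitX.IH(2)[of "shift2 (a / 2) p" "a / 2" b "x - a / 2" y] SplitX.prems
      by (simp add: eval2_shift2)
  qed
next
  case (SplitY l r)
  show ?case
  proof (cases "y \<le> b / 2")
    case True
    then show ?thesis using SplitY by auto
  next
    case False
    then show ?thesis
      using SplitY.IH(2)[of "map (shift1 (b / 2)) p" a "b / 2" x "y - b / 2"] SplitY.prems
      by (simp add: eval2_shift1)
  qed
qed

lemma polynomial_nonneg_on_box:
  assumes "certifies s (shift2 x0 (map (shift1 y0) p)) (x1 - x0) (y1 - y0)"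
    and "x0 \<le> x" "x \<le> x1" "y0 \<le> y" "y \<le> y1"
  shows "0 \<le> eval2 p x y"
  using certifies_nonneg[OF assms(1), of "x - x0" "y - y0"] assms(2-)
  by (simp add: eval2_shift2 eval2_shift1)

lemma polynomial_nonneg_on_interval:
  assumes "certifies s (shift2 x0 (map (\<lambda>c. [c]) p)) (x1 - x0) 0" and "x0 \<le> x" "x \<le> x1"
  shows "0 \<le> eval1 p x"
proof -
  have "eval2 (map (\<lambda>c. [c]) p) u 0 = eval1 p u" for u
    by (induction p) simp_all
  then show ?thesis
    using certifies_nonneg[OF assms(1), of "x - x0" 0] assms(2-) by (simp add: eval2_shift2)
qed

section \<open>The pieces of the Bellman function and their polynomial inequalities\<close>

text \<open>
  The variable of \<open>mid\<close> and \<open>tail\<close> is the density minus \<open>1 / 2\<close>.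

  A parabola for the densities between \<open>1 / 4\<close> and \<open>1 / 2\<close>.  It has the value \<open>0.4985\<close> at \<open>1 / 2\<close>
  and at \<open>1 / 4\<close> a value just above \<open>0.997 * ell (1 / 4)\<close>.  Its curvature \<open>67 / 20\<close> is a compromise: more
  curvature costs the two-point inequality below \<open>1 / 2\<close>, and less curvature increases the slope at
  \<open>1 / 2\<close> and leaves too little room for a continuation that descends to \<open>0\<close> at density \<open>1\<close>.
\<close>

definition mid :: "real \<Rightarrow> real" where
  "mid v = 997 / 2000 + 33 / 200 * v - 67 / 40 * v\<^sup>2"

text \<open>
  The continuation beyond \<open>1 / 2\<close>, with the slope of \<open>mid\<close> at \<open>1 / 2\<close> and with \<open>tail (1 / 2) = 0\<close>.  A
  twice differentiable function \<open>B\<close> with the two-point property satisfies \<open>- B * B'' \<le> 2\<close>; with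
  equality this is the differential equation of the Gaussian isoperimetric profile up to scaling.
  The sextic term lets the curvature grow towards \<open>1\<close> much as the solutions of that equation do,
  but \<open>tail\<close> stays within the bound.
\<close>

definition tail :: "real \<Rightarrow> real" where
  "tail v = mid v - 59 / 200 * v\<^sup>2 - 708 / 125 * v ^ 6"

text \<open>
  A polynomial lower bound for \<open>0.997 * ell\<close> near \<open>0\<close>, where \<open>ell\<close> exceeds \<open>mid\<close>.  The variable is the
  density itself.
\<close>

definition low :: "real \<Rightarrow> real" where
  "low x = 99 / 50 * x - 243 / 100 * x\<^sup>2"

text \<open>
  For a pair of densities \<open>x \<le> y\<close> put \<open>y = 1 / 2 + v\<close> and \<open>x = y - 2 * h\<close>, so that the midpoint is
  \<open>1 / 2 + v - h\<close>.  Since \<open>mid\<close> is quadratic, \<open>2 * mid (v - h) - mid (v - 2 * h) = mid v + 67 / 20 * h\<^sup>2\<close>.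
  The inequalities \<open>near_*\<close> below are instances of the first alternative of the two-point
  inequality, after squaring; the inequalities \<open>far_*\<close> are instances of the second one, where
  \<open>2071 / 5000\<close> is a lower bound for \<open>sqrt 2 - 1\<close>.  For fixed \<open>v\<close> both need to be known only at the ends
  of a range of \<open>h\<close>.  The ends are \<open>h = v\<close> (the midpoint is \<open>1 / 2\<close>), \<open>h = (1 / 2 + v) / 2\<close> (here \<open>x = 0\<close>),
  \<open>h = v / 2\<close> (here \<open>x = 1 / 2\<close>), and thresholds between \<open>29 / 125\<close> and \<open>6 / 25\<close>, near which \<open>2 * h\<close> is
  about \<open>B y\<close> and the two alternatives are about equally strong.

  In each proof the list contains the coefficients of the difference of the two sides.
\<close>

lemma tail_nonneg:
  fixes z :: real
  assumes "0 \<le> z" "z \<le> 1 / 2"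
  shows "0 \<le> tail (1 / 2 - z)"
proof -
  have "0 \<le> eval1 [0, 2867 / 1000, - 182 / 25, 354 / 25, - 531 / 25, 2124 / 125, - 708 / 125] z"
    by (rule polynomial_nonneg_on_interval[of "SplitX Box Box" "0" _ "1 / 2"])
      (use assms in simp_all)
  also have "\<dots> = tail (1 / 2 - z)"
    unfolding mid_def tail_def low_def by (simp add: field_simps) algebra
  finally show ?thesis by simp
qed

lemma far_at_half:
  fixes v :: real
  assumes "19 / 80 \<le> v" "v \<le> 1 / 2"
  shows "mid v + 67 / 20 * v\<^sup>2
    \<le> 2 * v + 2071 / 5000 * tail v"
proof -
  have "0 \<le> eval1 [- 2920213 / 10000000, 1903343 / 1000000, - 1245487 / 500000, 0, 0, 0, -
      366567 / 156250] v"
    by (rule polynomial_nonneg_on_interval[of "Box" "19 / 80" _ "1 / 2"])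
      (use assms in simp_all)
  also have "\<dots> = 2 * v + 2071 / 5000 * tail v - (mid v + 67 / 20 * v\<^sup>2)"
    unfolding mid_def tail_def low_def by (simp add: field_simps) algebra
  finally show ?thesis by simp
qed

lemma far_at_zero:
  fixes v :: real
  assumes "4 / 25 \<le> v" "v \<le> 1 / 2"
  shows "mid v + 67 / 20 * ((1 / 2 + v) / 2)\<^sup>2
    \<le> 2 * ((1 / 2 + v) / 2) + 2071 / 5000 * tail v"
proof -
  have "0 \<le> eval1 [- 13963 / 10000000, 65843 / 1000000, 10763 / 500000, 0, 0, 0, - 366567 / 156250] v"
    by (rule polynomial_nonneg_on_interval[of "Box" "4 / 25" _ "1 / 2"])
      (use assms in simp_all)
  also have "\<dots> = 2 * ((1 / 2 + v) / 2) + 2071 / 5000 * tail v - (mid v + 67 / 20 * ((1 / 2 + v) / 2)\<^sup>2)"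
    unfolding mid_def tail_def low_def by (simp add: field_simps) algebra
  finally show ?thesis by simp
qed

lemma far_at_threshold:
  fixes v :: real
  assumes "4 / 25 \<le> v" "v \<le> 19 / 80"
  shows "mid v + 67 / 20 * (19 / 80)\<^sup>2
    \<le> 2 * (19 / 80) + 2071 / 5000 * tail v"
proof -
  have "0 \<le> eval1 [- 478579 / 80000000, - 96657 / 1000000, 429513 / 500000, 0, 0, 0, - 366567 / 156250] v"
    by (rule polynomial_nonneg_on_interval[of "Box" "4 / 25" _ "19 / 80"])
      (use assms in simp_all)
  also have "\<dots> = 2 * (19 / 80) + 2071 / 5000 * tail v - (mid v + 67 / 20 * (19 / 80)\<^sup>2)"
    unfolding mid_def tail_def low_def by (simp add: field_simps) algebra
  finally show ?thesis by simp
qed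

text \<open>
  For \<open>y\<close> slightly above \<open>1 / 2\<close> there is a gap of values \<open>h\<close> around \<open>6 / 25\<close> in which \<open>mid x\<close> is too
  small for both alternatives.  There \<open>x\<close> is at most \<open>1 / 5\<close> and the larger bound \<open>low x\<close> is used.
\<close>

lemma far_low_at_zero:
  fixes v :: real
  assumes "0 \<le> v" "v \<le> 4 / 25"
  shows "2 * mid (v - ((1 / 2 + v) / 2)) - low (1 / 2 + v - 2 * ((1 / 2 + v) / 2))
    \<le> 2 * ((1 / 2 + v) / 2) + 2071 / 5000 * tail v"
proof -
  have "0 \<le> eval1 [13537 / 10000000, 65843 / 1000000, 10763 / 500000, 0, 0, 0, - 366567 / 156250] v"
    by (rule polynomial_nonneg_on_interval[of "Box" "0" _ "4 / 25"])
      (use assms in simp_all)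
  also have "\<dots> = 2 * ((1 / 2 + v) / 2) + 2071 / 5000 * tail v - (2 * mid (v - ((1 / 2 + v) / 2)) - low (1 / 2 + v - 2 * ((1 / 2 + v) / 2)))"
    unfolding mid_def tail_def low_def by (simp add: field_simps) algebra
  finally show ?thesis by simp
qed

lemma far_low_at_threshold:
  fixes v :: real
  assumes "0 \<le> v" "v \<le> 4 / 25"
  shows "2 * mid (v - (6 / 25)) - low (1 / 2 + v - 2 * (6 / 25))
    \<le> 2 * (6 / 25) + 2071 / 5000 * tail v"
proof -
  have "0 \<le> eval1 [2667 / 10000000, 13143 / 1000000, 52013 / 500000, 0, 0, 0, - 366567 / 156250] v"
    by (rule polynomial_nonneg_on_interval[of "Box" "0" _ "4 / 25"])
      (use assms in simp_all)
  also have "\<dots> = 2 * (6 / 25) + 2071 / 5000 * tail v - (2 * mid (v - (6 / 25)) - low (1 / 2 + v - 2 * (6 / 25)))"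
    unfolding mid_def tail_def low_def by (simp add: field_simps) algebra
  finally show ?thesis by simp
qed

lemma far_straddling:
  fixes v :: real
  assumes "8 / 25 \<le> v" "v \<le> 1 / 2"
  shows "mid v + 67 / 20 * (v / 2)\<^sup>2 - 59 / 100 * (v - v / 2)\<^sup>2
    \<le> 2 * (v / 2) + 2071 / 5000 * tail v"
proof -
  have "0 \<le> eval1 [- 2920213 / 10000000, 903343 / 1000000, 84513 / 500000, 0, 0, 0, - 366567 / 156250] v"
    by (rule polynomial_nonneg_on_interval[of "Box" "8 / 25" _ "1 / 2"])
      (use assms in simp_all)
  also have "\<dots> = 2 * (v / 2) + 2071 / 5000 * tail v - (mid v + 67 / 20 * (v / 2)\<^sup>2 - 59 / 100 * (v - v / 2)\<^sup>2)"
    unfolding mid_def tail_def low_def by (simp add: field_simps) algebra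
  finally show ?thesis by simp
qed

text \<open>
  The first alternative for \<open>h = v\<close>, divided by \<open>v\<^sup>2\<close>.
\<close>

lemma near_at_half:
  fixes v :: real
  assumes "0 \<le> v" "v \<le> 19 / 80"
  shows "(67 / 10) * mid v + (67 / 20 * v)\<^sup>2 + (59 / 200 + 708 / 125 * v ^ 4) * (mid v + tail v)
    \<le> 4"
proof -
  have "0 \<le> eval1 [73187 / 200000, - 24057 / 20000, 43011 / 40000, 0, - 176469 / 31250, - 5841 /
      3125, 69738 / 3125, 0, 0, 0, 501264 / 15625] v"
    by (rule polynomial_nonneg_on_interval[of "Box" "0" _ "19 / 80"])
      (use assms in simp_all)
  also have "\<dots> = 4 - ((67 / 10) * mid v + (67 / 20 * v)\<^sup>2 + (59 / 200 + 708 / 125 * v ^ 4) * (mid v + tail v))"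
    unfolding mid_def tail_def low_def by (simp add: field_simps) algebra
  finally show ?thesis by simp
qed

lemma near_at_threshold_small:
  fixes v :: real
  assumes "0 \<le> v" "v \<le> 4 / 25"
  shows "(mid v + 67 / 20 * (29 / 125)\<^sup>2)\<^sup>2
    \<le> 4 * (29 / 125)\<^sup>2 + (tail v)\<^sup>2"
proof -
  have "0 \<le> eval1 [588806807 / 195312500000, - 1859451 / 31250000, 7748121 / 25000000, - 1947 /
      20000, 43011 / 40000, 0, - 176469 / 31250, - 5841 / 3125, 69738 / 3125, 0, 0, 0, 501264 /
      15625] v"
    by (rule polynomial_nonneg_on_interval[of "SplitX (SplitX Box (SplitX Box Box)) (SplitX (SplitX
        Box Box) Box)" "0" _ "4 / 25"])
      (use assms in simp_all)
  also have "\<dots> = 4 * (29 / 125)\<^sup>2 + (tail v)\<^sup>2 - ((mid v + 67 / 20 * (29 / 125)\<^sup>2)\<^sup>2)"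
    unfolding mid_def tail_def low_def by (simp add: field_simps) algebra
  finally show ?thesis by simp
qed

lemma near_at_threshold:
  fixes v :: real
  assumes "4 / 25 \<le> v" "v \<le> 19 / 80"
  shows "(mid v + 67 / 20 * (19 / 80)\<^sup>2)\<^sup>2
    \<le> 4 * (19 / 80)\<^sup>2 + (tail v)\<^sup>2"
proof -
  have "0 \<le> eval1 [24980839 / 16384000000, - 798171 / 12800000, 4337973 / 12800000, - 1947 /
      20000, 43011 / 40000, 0, - 176469 / 31250, - 5841 / 3125, 69738 / 3125, 0, 0, 0, 501264 /
      15625] v"
    by (rule polynomial_nonneg_on_interval[of "Box" "4 / 25" _ "19 / 80"])
      (use assms in simp_all)
  also have "\<dots> = 4 * (19 / 80)\<^sup>2 + (tail v)\<^sup>2 - ((mid v + 67 / 20 * (19 / 80)\<^sup>2)\<^sup>2)"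
    unfolding mid_def tail_def low_def by (simp add: field_simps) algebra
  finally show ?thesis by simp
qed

lemma near_low:
  fixes v h :: real
  assumes "0 \<le> v" "v \<le> 4 / 25" "29 / 125 \<le> h" "h \<le> 6 / 25"
  shows "(2 * mid (v - h) - low (1 / 2 + v - 2 * h))\<^sup>2
    \<le> 4 * h\<^sup>2 + (mid v - 3 / 10 * v\<^sup>2)\<^sup>2"
proof -
  have "0 \<le> eval2
      [[- 32277 / 250000, 151167 / 100000, - 534163 / 100000, 78351 / 5000, - 405769 / 10000],
       [- 158823 / 200000, 281519 / 50000, - 10854 / 625, 96187 / 2500],
       [- 141957 / 100000, 306 / 125, 6501 / 2500],
       [15669 / 20000, - 3473 / 625],
       [122169 / 40000]] v h"
    by (rule polynomial_nonneg_on_box[of "SplitX Box Box" "0" "29 / 125" _ "4 / 25" "6 / 25"])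
      (use assms in simp_all)
  also have "\<dots> = 4 * h\<^sup>2 + (mid v - 3 / 10 * v\<^sup>2)\<^sup>2 - ((2 * mid (v - h) - low (1 / 2 + v - 2 * h))\<^sup>2)"
    unfolding mid_def tail_def low_def by (simp add: field_simps) algebra
  finally show ?thesis by simp
qed

text \<open>
  For a pair with \<open>x \<le> 1 / 2\<close> whose midpoint exceeds \<open>1 / 2\<close> the substitution
  \<open>h = s * v\<close> allows to divide by \<open>v\<^sup>2\<close>, which removes the zero at \<open>v = 0\<close>.  The constants \<open>3 / 10\<close>, \<open>31 / 100\<close> and \<open>9 / 25\<close> are
  upper bounds for \<open>59 / 200 + 708 / 125 * v ^ 4\<close>, the ratio of \<open>mid v - tail v\<close> to \<open>v\<^sup>2\<close>, on the three ranges.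
\<close>

lemma near_straddling_1:
  fixes v s :: real
  assumes "0 \<le> v" "v \<le> 3 / 20" "1 / 2 \<le> s" "s \<le> 1"
  shows "(67 / 20 * s\<^sup>2 - 59 / 100 * (1 - s)\<^sup>2 + 3 / 10) *
      (2 * mid v + (67 / 20 * s\<^sup>2 - 59 / 100 * (1 - s)\<^sup>2 - 3 / 10) * v\<^sup>2)
    \<le> 4 * s\<^sup>2"
proof -
  have "0 \<le> eval2
      [[28913 / 100000, - 58823 / 50000, 31207 / 25000],
       [957 / 10000, - 1947 / 5000, - 2277 / 2500],
       [- 1537 / 1250, 26727 / 5000, 6944 / 625, - 4071 / 625, - 4761 / 625]] v s"
    by (rule polynomial_nonneg_on_box[of "SplitX (SplitX (SplitY (SplitX (SplitX Box Box) (SplitX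
        Box Box)) Box) (SplitY (SplitX (SplitX Box Box) (SplitY Box Box)) Box)) (SplitY (SplitY Box
        Box) (SplitY Box Box))" "0" "1 / 2" _ "3 / 20" "1"])
      (use assms in simp_all)
  also have "\<dots> = 4 * s\<^sup>2 - ((67 / 20 * s\<^sup>2 - 59 / 100 * (1 - s)\<^sup>2 + 3 / 10) *
      (2 * mid v + (67 / 20 * s\<^sup>2 - 59 / 100 * (1 - s)\<^sup>2 - 3 / 10) * v\<^sup>2))"
    unfolding mid_def tail_def low_def by (simp add: field_simps) algebra
  finally show ?thesis by simp
qed

lemma near_straddling_2:
  fixes v s :: real
  assumes "3 / 20 \<le> v" "v \<le> 11 / 50" "1 / 2 \<le> s" "s \<le> 1"
  shows "(67 / 20 * s\<^sup>2 - 59 / 100 * (1 - s)\<^sup>2 + 31 / 100) *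
      (2 * mid v + (67 / 20 * s\<^sup>2 - 59 / 100 * (1 - s)\<^sup>2 - 31 / 100) * v\<^sup>2)
    \<le> 4 * s\<^sup>2"
proof -
  have "0 \<le> eval2
      [[6979 / 25000, - 58823 / 50000, 31207 / 25000],
       [231 / 2500, - 1947 / 5000, - 2277 / 2500],
       [- 119 / 100, 26727 / 5000, 6944 / 625, - 4071 / 625, - 4761 / 625]] v s"
    by (rule polynomial_nonneg_on_box[of "SplitY Box Box" "3 / 20" "1 / 2" _ "11 / 50" "1"])
      (use assms in simp_all)
  also have "\<dots> = 4 * s\<^sup>2 - ((67 / 20 * s\<^sup>2 - 59 / 100 * (1 - s)\<^sup>2 + 31 / 100) *
      (2 * mid v + (67 / 20 * s\<^sup>2 - 59 / 100 * (1 - s)\<^sup>2 - 31 / 100) * v\<^sup>2))"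
    unfolding mid_def tail_def low_def by (simp add: field_simps) algebra
  finally show ?thesis by simp
qed

lemma near_straddling_3:
  fixes v s :: real
  assumes "11 / 50 \<le> v" "v \<le> 8 / 25" "1 / 2 \<le> s" "s \<le> 1"
  shows "(67 / 20 * s\<^sup>2 - 59 / 100 * (1 - s)\<^sup>2 + 9 / 25) *
      (2 * mid v + (67 / 20 * s\<^sup>2 - 59 / 100 * (1 - s)\<^sup>2 - 9 / 25) * v\<^sup>2)
    \<le> 4 * s\<^sup>2"
proof -
  have "0 \<le> eval2
      [[22931 / 100000, - 58823 / 50000, 31207 / 25000],
       [759 / 10000, - 1947 / 5000, - 2277 / 2500],
       [- 989 / 1000, 26727 / 5000, 6944 / 625, - 4071 / 625, - 4761 / 625]] v s"
    by (rule polynomial_nonneg_on_box[of "SplitY Box Box" "11 / 50" "1 / 2" _ "8 / 25" "1"])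
      (use assms in simp_all)
  also have "\<dots> = 4 * s\<^sup>2 - ((67 / 20 * s\<^sup>2 - 59 / 100 * (1 - s)\<^sup>2 + 9 / 25) *
      (2 * mid v + (67 / 20 * s\<^sup>2 - 59 / 100 * (1 - s)\<^sup>2 - 9 / 25) * v\<^sup>2))"
    unfolding mid_def tail_def low_def by (simp add: field_simps) algebra
  finally show ?thesis by simp
qed

text \<open>
  The factor \<open>197 / 50 + 4248 / 25 * v ^ 4\<close> is minus the second derivative of \<open>tail\<close>, so this is the
  infinitesimal form \<open>- B * B'' \<le> 2\<close> of the two-point inequality.  Where \<open>tail\<close> increases a slightly
  stronger form is needed.
\<close>

lemma tail_curvature:
  fixes v :: real
  assumes "0 \<le> v" "v \<le> 1 / 2"
  shows "(197 / 50 + 4248 / 25 * v ^ 4) * tail v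
    \<le> 2"
proof -
  have "0 \<le> eval1 [3591 / 100000, - 6501 / 10000, 38809 / 5000, 0, - 529407 / 6250, - 17523 /
      625, 1115808 / 3125, 0, 0, 0, 3007584 / 3125] v"
    by (rule polynomial_nonneg_on_interval[of "SplitX (SplitX (SplitX (SplitX Box Box) Box) Box)
        (SplitX (SplitX Box (SplitX Box Box)) Box)" "0" _ "1 / 2"])
      (use assms in simp_all)
  also have "\<dots> = 2 - ((197 / 50 + 4248 / 25 * v ^ 4) * tail v)"
    unfolding mid_def tail_def low_def by (simp add: field_simps) algebra
  finally show ?thesis by simp
qed

lemma tail_curvature_near_peak:
  fixes v :: real
  assumes "0 \<le> v" "v \<le> 1 / 10"
  shows "(197 / 50 + 4248 / 25 * v ^ 4) * (2 * tail v - 997 / 2000)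
    \<le> 2"
proof -
  have "0 \<le> eval1 [3591 / 100000, - 6501 / 5000, 38809 / 2500, 0, - 529407 / 6250, - 35046 /
      625, 2231616 / 3125, 0, 0, 0, 6015168 / 3125] v"
    by (rule polynomial_nonneg_on_interval[of "SplitX (SplitX Box (SplitX Box Box)) Box" "0" _ "1 / 10"])
      (use assms in simp_all)
  also have "\<dots> = 2 - ((197 / 50 + 4248 / 25 * v ^ 4) * (2 * tail v - 997 / 2000))"
    unfolding mid_def tail_def low_def by (simp add: field_simps) algebra
  finally show ?thesis by simp
qed

text \<open>
  The last four inequalities compare the polynomials with the rational bounds for the logarithm in
  \<open>(0.997 * ell)\<^sup>2\<close>.
\<close>

lemma mid_sq_ge_upper:
  fixes v :: real
  assumes "0 \<le> v" "v \<le> 1 / 8"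
  shows "(997 / 1000)\<^sup>2 * ((1 / 2 - v)\<^sup>2 + 3 / 2 * ((1 / 2 - v) / 4 - (1 / 2 - v) ^ 3))
    \<le> (mid (- v))\<^sup>2"
proof -
  have "0 \<le> eval1 [0, 335989 / 4000000, - 320191 / 800000, - 1876527 / 2000000, 4489 / 1600] v"
    by (rule polynomial_nonneg_on_interval[of "Box" "0" _ "1 / 8"])
      (use assms in simp_all)
  also have "\<dots> = (mid (- v))\<^sup>2 - ((997 / 1000)\<^sup>2 * ((1 / 2 - v)\<^sup>2 + 3 / 2 * ((1 / 2 - v) / 4 - (1 / 2 - v) ^ 3)))"
    unfolding mid_def tail_def low_def by (simp add: field_simps) algebra
  finally show ?thesis by simp
qed

lemma mid_sq_ge_lower:
  fixes x :: real
  assumes "1 / 4 \<le> x" "x \<le> 3 / 8"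
  shows "(997 / 1000)\<^sup>2 * x\<^sup>2 * (2 * (4 * x + 1) - 72 / 25 * (4 * x - 1))
    \<le> (mid (x - 1 / 2))\<^sup>2 * (4 * x + 1)"
proof -
  have "0 \<le> eval1 [121 / 16000000, - 40359 / 4000000, - 74821571 / 50000000, 136427021 /
      12500000, - 174803 / 8000, 4489 / 400] x"
    by (rule polynomial_nonneg_on_interval[of "Box" "1 / 4" _ "3 / 8"])
      (use assms in simp_all)
  also have "\<dots> = (mid (x - 1 / 2))\<^sup>2 * (4 * x + 1) - ((997 / 1000)\<^sup>2 * x\<^sup>2 * (2 * (4 * x + 1) - 72 / 25 * (4 * x - 1)))"
    unfolding mid_def tail_def low_def by (simp add: field_simps) algebra
  finally show ?thesis by simp
qed

lemma low_sq_le_upper: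
  fixes x :: real
  assumes "1 / 8 \<le> x" "x \<le> 1 / 5"
  shows "8 * x * (99 / 50 - 243 / 100 * x)\<^sup>2
    \<le> (997 / 1000)\<^sup>2 * (24 * x - 3 / 4 * (64 * x\<^sup>2 - 1))"
proof -
  have "0 \<le> eval1 [2982027 / 4000000, - 938373 / 125000, 1829373 / 62500, - 59049 / 1250] x"
    by (rule polynomial_nonneg_on_interval[of "SplitX Box Box" "1 / 8" _ "1 / 5"])
      (use assms in simp_all)
  also have "\<dots> = (997 / 1000)\<^sup>2 * (24 * x - 3 / 4 * (64 * x\<^sup>2 - 1)) - (8 * x * (99 / 50 - 243 / 100 * x)\<^sup>2)"
    unfolding mid_def tail_def low_def by (simp add: field_simps) algebra
  finally show ?thesis by simp
qed

lemma low_sq_le_lower: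
  fixes x :: real
  assumes "0 \<le> x" "x \<le> 1 / 8"
  shows "(99 / 50 - 243 / 100 * x)\<^sup>2 * (1 + 8 * x)
    \<le> (997 / 1000)\<^sup>2 * (3 * (1 + 8 * x) + 72 / 25 * (1 - 8 * x))"
proof -
  have "0 \<le> eval1 [48109323 / 25000000, - 64956723 / 3125000, 28431 / 400, - 59049 / 1250] x"
    by (rule polynomial_nonneg_on_interval[of "SplitX Box Box" "0" _ "1 / 8"])
      (use assms in simp_all)
  also have "\<dots> = (997 / 1000)\<^sup>2 * (3 * (1 + 8 * x) + 72 / 25 * (1 - 8 * x)) - ((99 / 50 - 243 / 100 * x)\<^sup>2 * (1 + 8 * x))"
    unfolding mid_def tail_def low_def by (simp add: field_simps) algebra
  finally show ?thesis by simp
qed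

section \<open>The two-point inequality for the Bellman function\<close>

lemma mid_nonneg:
  assumes "- 1 / 4 \<le> u" "u \<le> 0"
  shows "0 \<le> mid u"
proof -
  have "mid u = (997 / 2000 + 467 / 800 * u) + 67 / 40 * ((u + 1 / 4) * (- u))"
    by (simp add: mid_def power2_eq_square field_simps)
  moreover have "0 \<le> (u + 1 / 4) * (- u)"
    using assms by (intro mult_nonneg_nonneg) auto
  ultimately show ?thesis using assms by linarith
qed

text \<open>
  At \<open>1 / 2\<close> both sides are \<open>0.4985\<close>, and at \<open>1 / 4\<close> they differ by less than \<open>0.0001\<close>.  On each half of
  the interval a bound for the logarithm is used that is exact at the respective end.
\<close>

lemma ell_below_mid:
  assumes "1 / 4 \<le> x" "x \<le> 1 / 2"
  shows "997 / 1000 * ell x \<le> mid (x - 1 / 2)"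
proof -
  have x: "0 < x" using assms by simp
  have pos: "0 \<le> mid (x - 1 / 2)"
    using assms by (intro mid_nonneg) auto
  have l0: "0 \<le> log 2 (1 / x)" using assms by simp
  have "(997 / 1000)\<^sup>2 * (x\<^sup>2 * log 2 (1 / x)) \<le> (mid (x - 1 / 2))\<^sup>2"
  proof (cases "3 / 8 \<le> x")
    case True
    have "log 2 (1 / (2 * x)) \<le> 3 / 4 * (1 / (2 * x) - 2 * x)"
      using log2_le_rational[of "1 / (2 * x)"] assms by simp
    moreover have "log 2 (1 / x) = 1 + log 2 (1 / (2 * x))"
      using log_mult_pos[of 2 "1 / (2 * x)" 2] x by simp
    ultimately have "x\<^sup>2 * log 2 (1 / x) \<le> x\<^sup>2 * (1 + 3 / 4 * (1 / (2 * x) - 2 * x))"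
      using x by (intro mult_left_mono) auto
    also have "\<dots> = x\<^sup>2 + 3 / 2 * (x / 4 - x ^ 3)"
      using x by (simp add: field_simps power2_eq_square power3_eq_cube)
    finally have "(997 / 1000)\<^sup>2 * (x\<^sup>2 * log 2 (1 / x)) \<le> (997 / 1000)\<^sup>2 * (x\<^sup>2 + 3 / 2 * (x / 4 - x ^ 3))"
      by (intro mult_left_mono) auto
    also have "\<dots> \<le> (mid (x - 1 / 2))\<^sup>2"
      using mid_sq_ge_upper[of "1 / 2 - x"] True assms by simp
    finally show ?thesis .
  next
    case False
    have "72 / 25 * ((4 * x - 1) / (4 * x + 1)) \<le> log 2 (4 * x)"
      using log2_ge_rational[of "4 * x"] assms by simp
    moreover have "log 2 (4 * x) = 2 - log 2 (1 / x)"
      using log_mult_pos[of 4 x 2] log_pow_cancel[of 2 2] x by (simp add: log_divide)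
    ultimately have log: "log 2 (1 / x) \<le> 2 - 72 / 25 * ((4 * x - 1) / (4 * x + 1))"
      by linarith
    define P where "P = 2 * (4 * x + 1) - 72 / 25 * (4 * x - 1)"
    have P: "2 - 72 / 25 * ((4 * x - 1) / (4 * x + 1)) = P / (4 * x + 1)"
      using x by (simp add: P_def divide_simps)
    have "(997 / 1000)\<^sup>2 * (x\<^sup>2 * log 2 (1 / x)) \<le> (997 / 1000)\<^sup>2 * (x\<^sup>2 * (P / (4 * x + 1)))"
      using log unfolding P by (intro mult_left_mono) auto
    also have "\<dots> = (997 / 1000)\<^sup>2 * x\<^sup>2 * P / (4 * x + 1)"
      by simp
    also have "\<dots> \<le> (mid (x - 1 / 2))\<^sup>2"
      using mid_sq_ge_lower[of x] False assms x unfolding P_def by (subst pos_divide_le_eq) auto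
    finally show ?thesis .
  qed
  moreover have "(997 / 1000 * ell x)\<^sup>2 = (997 / 1000)\<^sup>2 * (x\<^sup>2 * log 2 (1 / x))"
    unfolding ell_def power_mult_distrib using l0 by (simp only: real_sqrt_pow2)
  ultimately have "(997 / 1000 * ell x)\<^sup>2 \<le> (mid (x - 1 / 2))\<^sup>2"
    by (simp only:)
  then show ?thesis using pos by (rule power2_le_imp_le)
qed

lemma low_below_ell:
  assumes "0 \<le> x" "x \<le> 1 / 5"
  shows "low x \<le> 997 / 1000 * ell x"
proof (cases "x = 0")
  case False
  then have x: "0 < x" using assms by simp
  have "(99 / 50 - 243 / 100 * x)\<^sup>2 \<le> (997 / 1000)\<^sup>2 * log 2 (1 / x)"
  proof (cases "1 / 8 \<le> x")
    case True
    have "log 2 (8 * x) \<le> 3 / 4 * (8 * x - 1 / (8 * x))"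
      using log2_le_rational[of "8 * x"] True by simp
    moreover have "log 2 (8 * x) = 3 - log 2 (1 / x)"
      using log_mult_pos[of 8 x 2] log_pow_cancel[of 2 3] x by (simp add: log_divide)
    ultimately have log: "3 - 3 / 4 * (8 * x - 1 / (8 * x)) \<le> log 2 (1 / x)" by linarith
    have "8 * x * (99 / 50 - 243 / 100 * x)\<^sup>2 \<le> (997 / 1000)\<^sup>2 * (24 * x - 3 / 4 * (64 * x\<^sup>2 - 1))"
      using low_sq_le_upper[of x] True assms by simp
    also have "24 * x - 3 / 4 * (64 * x\<^sup>2 - 1) = 8 * x * (3 - 3 / 4 * (8 * x - 1 / (8 * x)))"
      using x by (simp add: field_simps power2_eq_square)
    also have "(997 / 1000)\<^sup>2 * \<dots> \<le> (997 / 1000)\<^sup>2 * (8 * x * log 2 (1 / x))"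
      using log x by (intro mult_left_mono) auto
    finally show ?thesis using x by (simp add: mult.left_commute)
  next
    case False
    have "72 / 25 * ((1 / (8 * x) - 1) / (1 / (8 * x) + 1)) \<le> log 2 (1 / (8 * x))"
      using log2_ge_rational[of "1 / (8 * x)"] False x by simp
    also have "(1 / (8 * x) - 1) / (1 / (8 * x) + 1) = (1 - 8 * x) / (1 + 8 * x)"
      using x by (simp add: divide_simps)
    finally have log: "3 + 72 / 25 * ((1 - 8 * x) / (1 + 8 * x)) \<le> log 2 (1 / x)"
      using log_mult_pos[of "1 / (8 * x)" 8 2] log_pow_cancel[of 2 3] x by simp
    have "(99 / 50 - 243 / 100 * x)\<^sup>2 * (1 + 8 * x)
        \<le> (997 / 1000)\<^sup>2 * (3 * (1 + 8 * x) + 72 / 25 * (1 - 8 * x))"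
      using low_sq_le_lower[of x] False assms by simp
    also have "3 * (1 + 8 * x) + 72 / 25 * (1 - 8 * x)
        = (3 + 72 / 25 * ((1 - 8 * x) / (1 + 8 * x))) * (1 + 8 * x)"
      using x by (simp add: divide_simps)
    also have "(997 / 1000)\<^sup>2 * \<dots> \<le> (997 / 1000)\<^sup>2 * (log 2 (1 / x) * (1 + 8 * x))"
      using log x by (intro mult_left_mono mult_right_mono) auto
    finally show ?thesis using x by simp
  qed
  then have "99 / 50 - 243 / 100 * x \<le> 997 / 1000 * sqrt (log 2 (1 / x))"
    using real_le_rsqrt real_sqrt_mult[of "(997 / 1000)\<^sup>2" "log 2 (1 / x)"] by force
  from mult_left_mono[OF this, of x] show ?thesis
    using x by (simp add: low_def ell_def power2_eq_square algebra_simps)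
qed (simp add: low_def ell_def)

text \<open>
  A maximum of functions inherits the two-point inequality: it suffices to prove the inequality
  for the function that attains the maximum at the midpoint, with any lower bounds for \<open>bellman\<close> at
  the two ends.  The change from \<open>ell\<close> to \<open>mid\<close> creates a convex kink, which does no harm.
\<close>

definition bellman :: "real \<Rightarrow> real" where
  "bellman x = (if x \<le> 1 / 2 then max (997 / 1000 * ell x) (mid (x - 1 / 2)) else tail (x - 1 / 2))"

lemma bellman_ge_ell: "x \<le> 1 / 2 \<Longrightarrow> 997 / 1000 * ell x \<le> bellman x"
  by (simp add: bellman_def)

lemma bellman_ge_mid: "x \<le> 1 / 2 \<Longrightarrow> mid (x - 1 / 2) \<le> bellman x"
  by (simp add: bellman_def)

lemma bellman_ge_low: "0 \<le> x \<Longrightarrow> x \<le> 1 / 5 \<Longrightarrow> low x \<le> bellman x"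
  using low_below_ell[of x] bellman_ge_ell[of x] by linarith

lemma ell_half: "ell (1 / 2) = 1 / 2"
  by (simp add: ell_def)

lemma bellman_upper_half:
  assumes "1 / 2 \<le> x"
  shows "bellman x = tail (x - 1 / 2)"
proof (cases "x = 1 / 2")
  case True
  show ?thesis unfolding True by (simp add: bellman_def tail_def mid_def ell_half)
qed (use assms in \<open>simp add: bellman_def\<close>)

lemma ell_nonneg: "0 \<le> x \<Longrightarrow> x \<le> 1 \<Longrightarrow> 0 \<le> ell x"
  by (cases "x = 0") (simp_all add: ell_def)

lemma bellman_nonneg:
  assumes "0 \<le> x" "x \<le> 1"
  shows "0 \<le> bellman x"
proof (cases "x \<le> 1 / 2")
  case True
  then show ?thesis using bellman_ge_ell[of x] ell_nonneg[of x] assms by simp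
next
  case False
  then show ?thesis using bellman_upper_half[of x] tail_nonneg[of "1 - x"] assms by simp
qed

lemma bellman_0: "bellman 0 = 0" and bellman_1: "bellman 1 = 0"
  by (simp_all add: bellman_def ell_def mid_def tail_def power_divide)

lemma two_point_if_near:
  assumes "2 * B ((x + y) / 2) - B x \<le> T" "T\<^sup>2 \<le> (y - x)\<^sup>2 + (B y)\<^sup>2"
  shows "two_point B x y"
  using assms(1) real_le_rsqrt[OF assms(2)] unfolding two_point_def larger_slice_bound_def by linarith

lemma two_point_if_far:
  assumes "2 * B ((x + y) / 2) - B x \<le> T" "T \<le> (y - x) + 2071 / 5000 * B y" "0 \<le> B y"
  shows "two_point B x y"
proof -
  have "7071 / 5000 \<le> sqrt 2"
    by (rule real_le_rsqrt) (simp add: power2_eq_square)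
  then have "2071 / 5000 * B y \<le> (sqrt 2 - 1) * B y"
    using assms(3) by (intro mult_right_mono) auto
  with assms show ?thesis
    unfolding two_point_def larger_slice_bound_def by linarith
qed

lemma concave_quadratic_nonneg:
  fixes a b c w :: real
  assumes "0 \<le> b" "w0 \<le> w" "w \<le> w1"
    and "0 \<le> c + a * w0 - b * w0\<^sup>2" "0 \<le> c + a * w1 - b * w1\<^sup>2"
  shows "0 \<le> c + a * w - b * w\<^sup>2"
proof (cases "w0 = w1")
  case False
  have "0 \<le> (w1 - w) * (c + a * w0 - b * w0\<^sup>2) + (w - w0) * (c + a * w1 - b * w1\<^sup>2)
      + b * ((w - w0) * (w1 - w)) * (w1 - w0)"
    using assms by (intro add_nonneg_nonneg mult_nonneg_nonneg) auto
  also have "\<dots> = (w1 - w0) * (c + a * w - b * w\<^sup>2)"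
    by (simp add: algebra_simps power2_eq_square)
  finally show ?thesis using False assms by (simp add: zero_le_mult_iff)
qed (use assms in auto)

lemma mid_second_difference: "2 * mid (v - h) - mid (v - 2 * h) = mid v + 67 / 20 * h\<^sup>2"
  by (simp add: mid_def power2_eq_square field_simps)

text \<open>
  For fixed \<open>v\<close> the difference of the two sides is a concave quadratic function of \<open>h\<^sup>2\<close>.
\<close>

lemma near_between:
  assumes "u \<le> h" "h \<le> u'" "0 \<le> u"
    and "(mid v + 67 / 20 * u\<^sup>2)\<^sup>2 \<le> 4 * u\<^sup>2 + b\<^sup>2"
    and "(mid v + 67 / 20 * u'\<^sup>2)\<^sup>2 \<le> 4 * u'\<^sup>2 + b\<^sup>2"
  shows "(mid v + 67 / 20 * h\<^sup>2)\<^sup>2 \<le> 4 * h\<^sup>2 + b\<^sup>2"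
proof -
  have f: "4 * w + b\<^sup>2 - (mid v + 67 / 20 * w)\<^sup>2
    = (b\<^sup>2 - (mid v)\<^sup>2) + (4 - 67 / 10 * mid v) * w - (67 / 20)\<^sup>2 * w\<^sup>2" for w
    by (simp add: power2_eq_square algebra_simps)
  have "0 \<le> 4 * h\<^sup>2 + b\<^sup>2 - (mid v + 67 / 20 * h\<^sup>2)\<^sup>2"
    unfolding f
  proof (rule concave_quadratic_nonneg)
    show "u\<^sup>2 \<le> h\<^sup>2" "h\<^sup>2 \<le> u'\<^sup>2" using assms by (auto intro: power_mono)
  qed (use assms(4,5) f[of "u\<^sup>2"] f[of "u'\<^sup>2"] in simp_all)
  then show ?thesis by simp
qed

text \<open>
  The case \<open>e = 0\<close> serves midpoints up to \<open>1 / 2\<close>, and the case \<open>e = 1\<close> midpoints beyond \<open>1 / 2\<close>, where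
  \<open>tail\<close> takes the place of \<open>mid\<close> at the midpoint.
\<close>

lemma far_between:
  assumes "u \<le> h" "h \<le> u'"
    and "mid v + 67 / 20 * u\<^sup>2 - 59 / 100 * (v - u)\<^sup>2 * e \<le> 2 * u + b"
    and "mid v + 67 / 20 * u'\<^sup>2 - 59 / 100 * (v - u')\<^sup>2 * e \<le> 2 * u' + b"
    and e: "0 \<le> e" "e \<le> 1"
  shows "mid v + 67 / 20 * h\<^sup>2 - 59 / 100 * (v - h)\<^sup>2 * e \<le> 2 * h + b"
proof -
  have f: "2 * w + b - (mid v + 67 / 20 * w\<^sup>2 - 59 / 100 * (v - w)\<^sup>2 * e)
    = (b - mid v + 59 / 100 * v\<^sup>2 * e) + (2 - 59 / 50 * v * e) * w - (67 / 20 - 59 / 100 * e) * w\<^sup>2" for w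
    by (simp add: power2_eq_square field_simps)
  have "0 \<le> 2 * h + b - (mid v + 67 / 20 * h\<^sup>2 - 59 / 100 * (v - h)\<^sup>2 * e)"
    unfolding f
    by (rule concave_quadratic_nonneg[of _ u _ u']) (use assms f[of u] f[of u'] in simp_all)
  then show ?thesis by simp
qed

lemma far_low_between:
  assumes "u \<le> h" "h \<le> u'"
    and "2 * mid (v - u) - low (1 / 2 + v - 2 * u) \<le> 2 * u + b"
    and "2 * mid (v - u') - low (1 / 2 + v - 2 * u') \<le> 2 * u' + b"
  shows "2 * mid (v - h) - low (1 / 2 + v - 2 * h) \<le> 2 * h + b"
proof -
  have f: "2 * w + b - (2 * mid (v - w) - low (1 / 2 + v - 2 * w))
    = (b - 2 * mid v + low (1 / 2 + v)) + (2 + 33 / 100 - 67 / 10 * v - 99 / 25 + 243 / 25 * (1 / 2 + v)) * w - 637 / 100 * w\<^sup>2" for w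
    by (simp add: mid_def low_def power2_eq_square field_simps)
  have "0 \<le> 2 * h + b - (2 * mid (v - h) - low (1 / 2 + v - 2 * h))"
    unfolding f
    by (rule concave_quadratic_nonneg[of _ u _ u']) (use assms f[of u] f[of u'] in simp_all)
  then show ?thesis by simp
qed

lemma tail_ge_parabola: "0 \<le> v \<Longrightarrow> 59 / 200 + 708 / 125 * v ^ 4 \<le> d \<Longrightarrow> mid v - d * v\<^sup>2 \<le> tail v"
proof -
  assume d: "59 / 200 + 708 / 125 * v ^ 4 \<le> d"
  have "tail v = mid v - (59 / 200 + 708 / 125 * v ^ 4) * v\<^sup>2"
    by (simp add: tail_def algebra_simps flip: power_add)
  also have "\<dots> \<ge> mid v - d * v\<^sup>2"
    using d by (simp add: mult_right_mono)
  finally show ?thesis .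
qed

lemma tail_le_mid: "tail v \<le> mid v - 59 / 200 * v\<^sup>2"
  by (simp add: tail_def)

lemma tail_sq_ge_parabola:
  assumes "0 \<le> v" "v \<le> 8 / 25" "59 / 200 + 708 / 125 * v ^ 4 \<le> d" "d \<le> 1"
  shows "(mid v - d * v\<^sup>2)\<^sup>2 \<le> (tail v)\<^sup>2"
proof (rule power_mono)
  show "mid v - d * v\<^sup>2 \<le> tail v" by (rule tail_ge_parabola) (use assms in auto)
  have "v\<^sup>2 \<le> (8 / 25)\<^sup>2" using assms by (intro power_mono) auto
  moreover have "d * v\<^sup>2 \<le> 1 * v\<^sup>2" using assms by (intro mult_right_mono) auto
  ultimately show "0 \<le> mid v - d * v\<^sup>2" using assms by (simp add: mid_def power2_eq_square)
qed

text \<open>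
  Here \<open>y\<close> is at most \<open>1 / 2\<close>.  In terms of \<open>mid\<close> alone the first alternative amounts to
  \<open>2 * mid v + 67 / 20 * h\<^sup>2 \<le> 80 / 67\<close>.  This fails only for pairs close to \<open>(0, 1 / 2)\<close>, where \<open>low\<close> is
  used at \<open>x\<close> instead of \<open>mid\<close>.
\<close>

lemma two_point_mid_low:
  assumes "0 \<le> h" "v \<le> 0" "2 * h \<le> 1 / 2 + v"
    and "bellman (1 / 2 + v - h) = mid (v - h)"
  shows "two_point bellman (1 / 2 + v - 2 * h) (1 / 2 + v)"
proof -
  define x where "x = 1 / 2 + v - 2 * h"
  have x: "0 \<le> x" "x \<le> 1 / 2" using assms by (auto simp: x_def)
  have m: "(x + (1 / 2 + v)) / 2 = 1 / 2 + v - h" by (simp add: x_def)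
  have Bx: "mid (v - 2 * h) \<le> bellman x" using bellman_ge_mid[OF x(2)] by (simp add: x_def)
  have mid0: "0 \<le> mid (v - h)"
    using bellman_nonneg[of "1 / 2 + v - h"] assms by simp
  have "mid v - mid (v - h) = h * (33 / 200 + 67 / 40 * (h - 2 * v))"
    by (simp add: mid_def power2_eq_square field_simps)
  moreover have "0 \<le> h * (33 / 200 + 67 / 40 * (h - 2 * v))"
    using assms by (intro mult_nonneg_nonneg add_nonneg_nonneg) auto
  ultimately have midv: "0 \<le> mid v" using mid0 by linarith
  have midv': "mid v \<le> 997 / 2000" unfolding mid_def using assms(2) zero_le_power2[of v] by linarith
  have By: "(mid v)\<^sup>2 \<le> (bellman (1 / 2 + v))\<^sup>2"
    using bellman_ge_mid[of "1 / 2 + v"] assms midv by (intro power_mono) auto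
  have yx: "(1 / 2 + v - x)\<^sup>2 = 4 * h\<^sup>2" by (simp add: x_def)
  have "two_point bellman x (1 / 2 + v)"
  proof (cases "h \<le> 6 / 25")
    case True
    show ?thesis
    proof (rule two_point_if_near)
      show "2 * bellman ((x + (1 / 2 + v)) / 2) - bellman x \<le> mid v + 67 / 20 * h\<^sup>2"
        unfolding m assms(4) using Bx mid_second_difference[of v h] by simp
      have "h\<^sup>2 \<le> (6 / 25)\<^sup>2" using True assms by (intro power_mono) auto
      then have "67 / 10 * mid v + (67 / 20)\<^sup>2 * h\<^sup>2 \<le> 4"
        using midv' by (simp add: power2_eq_square)
      from mult_right_mono[OF this, of "h\<^sup>2"]
      have "(mid v + 67 / 20 * h\<^sup>2)\<^sup>2 \<le> 4 * h\<^sup>2 + (mid v)\<^sup>2"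
        by (simp add: power2_eq_square algebra_simps)
      with By show "(mid v + 67 / 20 * h\<^sup>2)\<^sup>2 \<le> (1 / 2 + v - x)\<^sup>2 + (bellman (1 / 2 + v))\<^sup>2"
        unfolding yx by linarith
    qed
  next
    case False
    have h: "6 / 25 \<le> h" "h \<le> 1 / 4" using False assms by auto
    have xs: "0 \<le> x" "x \<le> 1 / 50" using h assms by (auto simp: x_def)
    \<comment> \<open>The gain \<open>?g\<close> is \<open>low - mid\<close> at density \<open>0\<close>, where it is least in the range of \<open>x\<close>.\<close>
    let ?g = "11 / 4000 :: real"
    have "low x - mid (v - 2 * h) = ?g + x * (7 / 50 - 151 / 200 * x)"
      unfolding x_def low_def mid_def by (simp add: power2_eq_square field_simps)
    moreover have "0 \<le> x * (7 / 50 - 151 / 200 * x)" using xs by (intro mult_nonneg_nonneg) auto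
    moreover have "low x \<le> bellman x" using xs by (intro bellman_ge_low) auto
    ultimately have Bx': "mid (v - 2 * h) + ?g \<le> bellman x"
      by linarith
    show ?thesis
    proof (rule two_point_if_near)
      show "2 * bellman ((x + (1 / 2 + v)) / 2) - bellman x \<le> mid v + (67 / 20 * h\<^sup>2 - ?g)"
        unfolding m assms(4) using Bx' mid_second_difference[of v h] by simp
      have w: "(6 / 25)\<^sup>2 \<le> h\<^sup>2" "h\<^sup>2 \<le> (1 / 4)\<^sup>2"
        using h by (auto intro!: power_mono)
      let ?k = "67 / 20 * h\<^sup>2 - ?g"
      have "0 \<le> ?k" using w by (simp add: power2_eq_square)
      then have "?k * (2 * mid v + ?k) \<le> ?k * (997 / 1000 + ?k)"
        using midv' by (intro mult_left_mono) auto
      also have "0 \<le> (?g * (997 / 1000) - ?g\<^sup>2) + (4 - 67 / 20 * (997 / 1000) + 67 / 10 * ?g) * h\<^sup>2 - (67 / 20)\<^sup>2 * (h\<^sup>2)\<^sup>2"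
        by (rule concave_quadratic_nonneg[OF _ w]) (simp_all add: power2_eq_square)
      then have "?k * (997 / 1000 + ?k) \<le> 4 * h\<^sup>2"
        by (simp add: power2_eq_square algebra_simps)
      finally have "(mid v + ?k)\<^sup>2 \<le> 4 * h\<^sup>2 + (mid v)\<^sup>2"
        by (simp add: power2_eq_square algebra_simps)
      with By show "(mid v + ?k)\<^sup>2 \<le> (1 / 2 + v - x)\<^sup>2 + (bellman (1 / 2 + v))\<^sup>2"
        unfolding yx by linarith
    qed
  qed
  then show ?thesis by (simp add: x_def)
qed

text \<open>
  Here \<open>y\<close> is at least \<open>1 / 2\<close> and the midpoint at most \<open>1 / 2\<close>.  For \<open>v \<ge> 4 / 25\<close> the second
  alternative takes over from the first one at \<open>h = 19 / 80\<close>; for smaller \<open>v\<close> there is a gap between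
  their ranges, which \<open>low\<close> closes.
\<close>

lemma two_point_mid_high:
  assumes "0 \<le> v" "v \<le> h" "2 * h \<le> 1 / 2 + v" "v \<le> 1 / 2"
    and "bellman (1 / 2 + v - h) = mid (v - h)"
  shows "two_point bellman (1 / 2 + v - 2 * h) (1 / 2 + v)"
proof -
  define x where "x = 1 / 2 + v - 2 * h"
  have x: "0 \<le> x" "x \<le> 1 / 2" using assms by (auto simp: x_def)
  have m: "(x + (1 / 2 + v)) / 2 = 1 / 2 + v - h" by (simp add: x_def)
  have By: "bellman (1 / 2 + v) = tail v" using bellman_upper_half[of "1 / 2 + v"] assms by simp
  have By0: "0 \<le> bellman (1 / 2 + v)" using bellman_nonneg assms by simp
  have yx: "(1 / 2 + v - x)\<^sup>2 = 4 * h\<^sup>2" "1 / 2 + v - x = 2 * h" by (simp_all add: x_def power2_eq_square)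
  have T: "2 * bellman ((x + (1 / 2 + v)) / 2) - bellman x \<le> mid v + 67 / 20 * h\<^sup>2"
    unfolding m assms(5) using bellman_ge_mid[OF x(2)] mid_second_difference[of v h] by (simp add: x_def)
  have near: "two_point bellman x (1 / 2 + v)" if "(mid v + 67 / 20 * h\<^sup>2)\<^sup>2 \<le> 4 * h\<^sup>2 + (tail v)\<^sup>2"
    by (rule two_point_if_near[OF T]) (use that in \<open>simp only: yx(1) By\<close>)
  have far: "two_point bellman x (1 / 2 + v)" if "mid v + 67 / 20 * h\<^sup>2 \<le> 2 * h + 2071 / 5000 * tail v"
    by (rule two_point_if_far[OF T _ By0]) (use that in \<open>simp only: yx(2) By\<close>)
  have near_half: "(mid v + 67 / 20 * v\<^sup>2)\<^sup>2 \<le> 4 * v\<^sup>2 + (tail v)\<^sup>2" if "v \<le> 19 / 80"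
  proof -
    define D where "D = 59 / 200 + 708 / 125 * v ^ 4"
    have tail: "tail v = mid v - D * v\<^sup>2"
      by (simp add: tail_def D_def algebra_simps flip: power_add)
    have "(mid v + 67 / 20 * v\<^sup>2)\<^sup>2 - (tail v)\<^sup>2
        = (67 / 10 * mid v + (67 / 20 * v)\<^sup>2 + D * (mid v + tail v)) * v\<^sup>2"
      unfolding tail by (simp add: power2_eq_square algebra_simps)
    also have "\<dots> \<le> 4 * v\<^sup>2"
      using near_at_half[OF assms(1) that] by (intro mult_right_mono) (auto simp: D_def)
    finally show ?thesis by simp
  qed
  have "two_point bellman x (1 / 2 + v)"
  proof (cases "4 / 25 \<le> v")
    case True
    show ?thesis
    proof (cases "h \<le> 19 / 80")
      case near_h: True
      show ?thesis
        by (rule near, rule near_between[of v _ "19 / 80"])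
           (use assms True near_h near_half near_at_threshold[of v] in auto)
    next
      case far_h: False
      have "mid v + 67 / 20 * (max v (19 / 80))\<^sup>2 \<le> 2 * max v (19 / 80) + 2071 / 5000 * tail v"
        using far_at_half[of v] far_at_threshold[of v] True assms by (auto simp: max_def)
      then show ?thesis
        using far_between[of "max v (19 / 80)" h "(1 / 2 + v) / 2" v 0 "2071 / 5000 * tail v"]
          far_at_zero[of v] True far_h assms by (intro far) auto
    qed
  next
    case False
    have Tlow: "2 * bellman ((x + (1 / 2 + v)) / 2) - bellman x \<le> 2 * mid (v - h) - low (1 / 2 + v - 2 * h)"
      if "29 / 125 \<le> h"
      unfolding m assms(5) using bellman_ge_low[of x] that False x by (simp add: x_def)
    consider "h \<le> 29 / 125" | "29 / 125 \<le> h" "h \<le> 6 / 25" | "6 / 25 \<le> h" by linarith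
    then show ?thesis
    proof cases
      case 1
      show ?thesis
        by (rule near, rule near_between[of v _ "29 / 125"])
           (use assms False 1 near_half near_at_threshold_small[of v] in auto)
    next
      case 2
      have "v ^ 4 \<le> (4 / 25) ^ 4" using False assms by (intro power_mono) auto
      then have "(mid v - 3 / 10 * v\<^sup>2)\<^sup>2 \<le> (tail v)\<^sup>2"
        using False assms by (intro tail_sq_ge_parabola) (auto simp: power_divide)
      then show ?thesis
        using near_low[of v h] False 2 assms
        by (intro two_point_if_near[OF Tlow[OF 2(1)]], unfold yx(1) By) linarith
    next
      case 3
      have "2 * mid (v - h) - low (1 / 2 + v - 2 * h) \<le> 2 * h + 2071 / 5000 * tail v"
        by (rule far_low_between[of "6 / 25" _ "(1 / 2 + v) / 2"])
           (use far_low_at_zero[of v] far_low_at_threshold[of v] False 3 assms in auto)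
      moreover have "29 / 125 \<le> h" using 3 by simp
      ultimately show ?thesis
        by (intro two_point_if_far[OF Tlow _ By0]) (simp_all only: yx(2) By)
    qed
  qed
  then show ?thesis by (simp add: x_def)
qed

text \<open>
  Here \<open>x\<close> is at most \<open>1 / 2\<close> and the midpoint at least \<open>1 / 2\<close>.  Near \<open>x = y = 1 / 2\<close> both sides of the
  inequality agree to first order, so the quadratic part \<open>59 / 200 * (v - h)\<^sup>2\<close> of the difference of \<open>mid\<close> and
  \<open>tail\<close> at the midpoint must not be given away.
\<close>

lemma two_point_straddling:
  assumes "0 \<le> v" "h \<le> v" "v \<le> 2 * h" "v \<le> 1 / 2"
  shows "two_point bellman (1 / 2 + v - 2 * h) (1 / 2 + v)"
proof -
  define x where "x = 1 / 2 + v - 2 * h"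
  have x: "0 \<le> x" "x \<le> 1 / 2" using assms by (auto simp: x_def)
  have m: "(x + (1 / 2 + v)) / 2 = 1 / 2 + v - h" by (simp add: x_def)
  have By: "bellman (1 / 2 + v) = tail v" using bellman_upper_half[of "1 / 2 + v"] assms by simp
  have By0: "0 \<le> bellman (1 / 2 + v)" using bellman_nonneg assms by simp
  have yx: "(1 / 2 + v - x)\<^sup>2 = 4 * h\<^sup>2" "1 / 2 + v - x = 2 * h" by (simp_all add: x_def power2_eq_square)
  have T: "2 * bellman ((x + (1 / 2 + v)) / 2) - bellman x
      \<le> mid v + 67 / 20 * h\<^sup>2 - 59 / 100 * (v - h)\<^sup>2"
    unfolding m using bellman_upper_half[of "1 / 2 + v - h"] bellman_ge_mid[OF x(2)]
      mid_second_difference[of v h] tail_le_mid[of "v - h"] assms by (simp add: x_def)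
  have "two_point bellman x (1 / 2 + v)"
  proof (cases "8 / 25 \<le> v")
    case True
    have "mid v + 67 / 20 * h\<^sup>2 - 59 / 100 * (v - h)\<^sup>2 * 1 \<le> 2 * h + 2071 / 5000 * tail v"
      by (rule far_between[of "v / 2" _ v]) (use far_at_half[of v] far_straddling[of v] assms True in auto)
    then show ?thesis
      by (intro two_point_if_far[OF T _ By0]) (simp only: yx(2) By mult_1_right)
  next
    case False
    show ?thesis
    proof (cases "v = 0")
      case True
      then have "h = 0" using assms by simp
      then show ?thesis
        by (intro two_point_if_near[OF T]) (simp only: yx(1) By, use True \<open>h = 0\<close> in \<open>simp add: tail_def\<close>)
    next
      case v0: False
      define s where "s = h / v"
      define K where "K = 67 / 20 * s\<^sup>2 - 59 / 100 * (1 - s)\<^sup>2"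
      have s: "1 / 2 \<le> s" "s \<le> 1" "h = s * v"
        using v0 assms by (auto simp: s_def field_simps)
      have K: "67 / 20 * h\<^sup>2 - 59 / 100 * (v - h)\<^sup>2 = K * v\<^sup>2"
        by (simp add: K_def s(3) power2_eq_square field_simps)
      have le: "(mid v + K * v\<^sup>2)\<^sup>2 \<le> 4 * h\<^sup>2 + (tail v)\<^sup>2"
        if "(K + d) * (2 * mid v + (K - d) * v\<^sup>2) \<le> 4 * s\<^sup>2"
          "59 / 200 + 708 / 125 * v ^ 4 \<le> d" "d \<le> 1" for d
      proof -
        have "(mid v + K * v\<^sup>2)\<^sup>2 = (mid v - d * v\<^sup>2)\<^sup>2 + (K + d) * (2 * mid v + (K - d) * v\<^sup>2) * v\<^sup>2"
          by (simp add: power2_eq_square algebra_simps)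
        also have "\<dots> \<le> (tail v)\<^sup>2 + 4 * s\<^sup>2 * v\<^sup>2"
          using that False assms by (intro add_mono tail_sq_ge_parabola mult_right_mono) auto
        finally show ?thesis by (simp add: s(3) power_mult_distrib)
      qed
      have v4: "v ^ 4 \<le> r ^ 4" if "v \<le> r" for r
        using that assms by (intro power_mono) auto
      have "(mid v + K * v\<^sup>2)\<^sup>2 \<le> 4 * h\<^sup>2 + (tail v)\<^sup>2"
      proof -
        consider "v \<le> 3 / 20" | "3 / 20 \<le> v" "v \<le> 11 / 50" | "11 / 50 \<le> v" by linarith
        then show ?thesis
        proof cases
          case 1
          then show ?thesis
            using near_straddling_1[of v s] s assms v4[of "3 / 20"]
            by (intro le[of "3 / 10"]) (auto simp: K_def power_divide)
        next
          case 2
          then show ?thesis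
            using near_straddling_2[of v s] s assms v4[of "11 / 50"]
            by (intro le[of "31 / 100"]) (auto simp: K_def power_divide)
        next
          case 3
          then show ?thesis
            using near_straddling_3[of v s] s assms False v4[of "8 / 25"]
            by (intro le[of "9 / 25"]) (auto simp: K_def power_divide)
        qed
      qed
      then show ?thesis
        using K by (intro two_point_if_near[OF T], unfold yx(1) By) (simp add: add_diff_eq[symmetric])
    qed
  qed
  then show ?thesis by (simp add: x_def)
qed

definition tail' :: "real \<Rightarrow> real" where
  "tail' v = 33 / 200 - 197 / 50 * v - 4248 / 125 * v ^ 5"

lemma tail_deriv: "(tail has_real_derivative tail' v) (at v)"
  unfolding tail_def[abs_def] mid_def tail'_def
  by (auto intro!: derivative_eq_intros)

lemma tail'_diff_le:
  assumes "0 \<le> p" "p \<le> t"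
  shows "0 \<le> tail' p - tail' t" "tail' p - tail' t \<le> (197 / 50 + 4248 / 25 * t ^ 4) * (t - p)"
proof -
  have e: "tail' p - tail' t = 197 / 50 * (t - p) + 4248 / 125 * (t ^ 5 - p ^ 5)"
    by (simp add: tail'_def field_simps)
  have "p ^ 5 \<le> t ^ 5" using assms by (intro power_mono) auto
  then show "0 \<le> tail' p - tail' t" unfolding e using assms by simp
  have "t ^ 5 - p ^ 5 = (t - p) * (t ^ 4 + t ^ 3 * p + t\<^sup>2 * p\<^sup>2 + t * p ^ 3 + p ^ 4)"
    by (simp add: algebra_simps power_numeral_reduce)
  also have "\<dots> \<le> (t - p) * (t ^ 4 + t ^ 3 * t + t\<^sup>2 * t\<^sup>2 + t * t ^ 3 + t ^ 4)"
    using assms by (intro mult_left_mono add_mono mult_mono power_mono) auto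
  also have "\<dots> = (t - p) * (5 * t ^ 4)"
    by (simp add: power_numeral_reduce)
  finally have "t ^ 5 - p ^ 5 \<le> (t - p) * (5 * t ^ 4)" .
  then have "tail' p - tail' t \<le> 197 / 50 * (t - p) + 4248 / 125 * ((t - p) * (5 * t ^ 4))"
    unfolding e by (intro add_left_mono mult_left_mono) auto
  also have "\<dots> = (197 / 50 + 4248 / 25 * t ^ 4) * (t - p)"
    by (simp add: field_simps)
  finally show "tail' p - tail' t \<le> (197 / 50 + 4248 / 25 * t ^ 4) * (t - p)" .
qed

text \<open>
  The factor \<open>2 * tail t - tail p\<close> is at most \<open>tail t\<close> unless \<open>tail p < tail t\<close>.  In that case \<open>t\<close> cannot lie
  far beyond the maximum of \<open>tail\<close>, and \<open>tail p\<close> is at least \<open>tail 0\<close>, because \<open>tail\<close> is concave.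
\<close>

lemma tail_curvature_secant:
  assumes "0 \<le> p" "p \<le> t" "t \<le> 1 / 2"
  shows "(197 / 50 + 4248 / 25 * t ^ 4) * (2 * tail t - tail p) \<le> 2"
proof -
  let ?\<kappa> = "197 / 50 + 4248 / 25 * t ^ 4"
  \<comment> \<open>The slope of the chord of \<open>tail\<close> from \<open>0\<close> to \<open>u\<close>.\<close>
  define b where "b = (\<lambda>u::real. 33 / 200 - 197 / 100 * u - 708 / 125 * u ^ 5)"
  have tail_b: "tail u = 997 / 2000 + u * b u" for u
    by (simp add: tail_def mid_def b_def algebra_simps power_numeral_reduce)
  have b_mono: "b t \<le> b p"
  proof -
    have "p ^ 5 \<le> t ^ 5" using assms by (intro power_mono) auto
    then show ?thesis unfolding b_def using assms by linarith
  qed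
  have \<kappa>: "0 \<le> ?\<kappa>" by simp
  show ?thesis
  proof (cases "tail t \<le> tail p")
    case True
    have "?\<kappa> * (2 * tail t - tail p) \<le> ?\<kappa> * tail t"
      using True by (intro mult_left_mono[OF _ \<kappa>]) simp
    with tail_curvature[of t] assms show ?thesis by linarith
  next
    case False
    have bp: "0 \<le> b p"
    proof (rule ccontr)
      assume "\<not> 0 \<le> b p"
      then have "t * b t \<le> p * b p"
        using b_mono assms by (smt (verit) mult_left_mono mult_right_mono_neg)
      then show False using False by (simp add: tail_b)
    qed
    have "0 \<le> p * b p" using bp assms by simp
    then have tp: "997 / 2000 \<le> tail p" by (simp add: tail_b)
    then have "0 < t * b t" using False tail_b[of t] by simp
    then have "0 < b t" using assms by (simp add: zero_less_mult_iff)
    moreover have "0 \<le> 708 / 125 * t ^ 5" using assms by simp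
    ultimately have "t \<le> 1 / 10" unfolding b_def by linarith
    have "?\<kappa> * (2 * tail t - tail p) \<le> ?\<kappa> * (2 * tail t - 997 / 2000)"
      using tp by (intro mult_left_mono[OF _ \<kappa>]) simp
    with tail_curvature_near_peak[of t] \<open>t \<le> 1 / 10\<close> assms show ?thesis by linarith
  qed
qed

text \<open>
  With \<open>y\<close> fixed, \<open>R d = 2 * B (y - d / 2) - B (y - d)\<close> satisfies \<open>R 0 = B y\<close>, and the curvature
  bound gives \<open>R * R' \<le> d\<close>.  Hence \<open>(R d)\<^sup>2 - d\<^sup>2\<close> decreases in \<open>d\<close>.
\<close>

lemma tail_two_point:
  assumes "0 \<le> v" "v \<le> 1 / 2" "0 \<le> d" "d \<le> v"
  shows "(2 * tail (v - d / 2) - tail (v - d))\<^sup>2 \<le> d\<^sup>2 + (tail v)\<^sup>2"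
proof -
  define R where "R = (\<lambda>d. 2 * tail (v - d / 2) - tail (v - d))"
  have "(R d)\<^sup>2 - d\<^sup>2 \<le> (R 0)\<^sup>2 - 0\<^sup>2"
  proof (rule DERIV_nonpos_imp_nonincreasing[OF assms(3)])
    fix r assume r: "0 \<le> r" "r \<le> d"
    let ?D = "tail' (v - r) - tail' (v - r / 2)"
    have R': "(R has_real_derivative ?D) (at r)"
      unfolding R_def
      by (rule derivative_eq_intros DERIV_chain'[OF _ tail_deriv] refl | simp)+
    have pt: "0 \<le> v - r" "v - r \<le> v - r / 2" "v - r / 2 \<le> 1 / 2" using r assms by auto
    let ?\<kappa> = "197 / 50 + 4248 / 25 * (v - r / 2) ^ 4"
    have D: "0 \<le> ?D" "?D \<le> ?\<kappa> * (r / 2)"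
      using tail'_diff_le[OF pt(1,2)] by auto
    have "R r * ?D \<le> r"
    proof (cases "0 \<le> R r")
      case True
      have "R r * ?D \<le> R r * (?\<kappa> * (r / 2))" using D True by (intro mult_left_mono) auto
      also have "\<dots> = ?\<kappa> * R r * (r / 2)" by simp
      also have "\<dots> \<le> 2 * (r / 2)"
        using tail_curvature_secant[OF pt] r by (intro mult_right_mono) (auto simp: R_def)
      finally show ?thesis by simp
    next
      case False
      then have "R r * ?D \<le> 0" using D by (intro mult_nonpos_nonneg) auto
      then show ?thesis using r by simp
    qed
    moreover have "((\<lambda>d. (R d)\<^sup>2 - d\<^sup>2) has_real_derivative 2 * (R r * ?D) - 2 * r) (at r)"
      by (rule derivative_eq_intros R' refl | simp)+
    ultimately show "\<exists>z. ((\<lambda>d. (R d)\<^sup>2 - d\<^sup>2) has_real_derivative z) (at r) \<and> z \<le> 0"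
      by (intro exI[of _ "2 * (R r * ?D) - 2 * r"]) auto
  qed
  then show ?thesis by (simp add: R_def)
qed

text \<open>
  If the midpoint is at most \<open>1 / 2\<close>, the active function there is \<open>ell\<close> or \<open>mid\<close>.  In the first case
  \<open>ell_below_mid\<close> forces the midpoint below \<open>1 / 4\<close>, as \<open>ell_two_point\<close> requires, and both ends lie in the
  half where \<open>bellman\<close> dominates \<open>ell\<close>.
\<close>

lemma bellman_two_point:
  assumes "0 \<le> x" "x \<le> y" "y \<le> 1"
  shows "two_point bellman x y"
proof -
  define v where "v = y - 1 / 2"
  define h where "h = (y - x) / 2"
  have xy: "x = 1 / 2 + v - 2 * h" "y = 1 / 2 + v" "(x + y) / 2 = 1 / 2 + v - h"
    by (simp_all add: v_def h_def field_simps)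
  have hv: "2 * h = y - x" "v = y - 1 / 2"
    by (simp_all add: v_def h_def)
  consider "(x + y) / 2 \<le> 1 / 2" "bellman ((x + y) / 2) \<noteq> mid (v - h)"
    | "(x + y) / 2 \<le> 1 / 2" "bellman ((x + y) / 2) = mid (v - h)"
    | "1 / 2 < (x + y) / 2" "x \<le> 1 / 2" | "1 / 2 < x"
    using assms by linarith
  then show ?thesis
  proof cases
    case 1
    have B: "bellman ((x + y) / 2) = 997 / 1000 * ell ((x + y) / 2)"
      using 1 unfolding xy(3) by (simp add: bellman_def max_def split: if_splits)
    have "(x + y) / 2 \<le> 1 / 4"
    proof (rule ccontr)
      assume "\<not> (x + y) / 2 \<le> 1 / 4"
      then have "997 / 1000 * ell ((x + y) / 2) \<le> mid (v - h)"
        using ell_below_mid[of "(x + y) / 2"] 1(1) unfolding xy(3) by simp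
      with bellman_ge_mid[OF 1(1)] B 1(2) show False unfolding xy(3) by simp
    qed
    then have y: "y \<le> 1 / 2" "x \<le> 1 / 2" using assms by auto
    let ?c = "997 / 1000 :: real"
    have "2 * bellman ((x + y) / 2) \<le> ?c * ell x + ?c * sqrt ((y - x)\<^sup>2 + (ell y)\<^sup>2)"
      using ell_two_point[OF assms(1,2) \<open>(x + y) / 2 \<le> 1 / 4\<close>] unfolding B by simp
    also have "?c * sqrt ((y - x)\<^sup>2 + (ell y)\<^sup>2) = sqrt (?c\<^sup>2 * (y - x)\<^sup>2 + (?c * ell y)\<^sup>2)"
    proof -
      have "?c\<^sup>2 * (y - x)\<^sup>2 + (?c * ell y)\<^sup>2 = ?c\<^sup>2 * ((y - x)\<^sup>2 + (ell y)\<^sup>2)"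
        by (simp only: power_mult_distrib distrib_left)
      then show ?thesis by (simp only: real_sqrt_mult real_sqrt_abs)
    qed
    also have "\<dots> \<le> sqrt ((y - x)\<^sup>2 + (bellman y)\<^sup>2)"
      using bellman_ge_ell[OF y(1)] ell_nonneg[of y] assms
      by (intro real_sqrt_le_mono add_mono power_mono mult_left_le_one_le) (auto simp: power2_eq_square)
    also have "?c * ell x \<le> bellman x" by (rule bellman_ge_ell[OF y(2)])
    finally show ?thesis
      unfolding two_point_def larger_slice_bound_def by simp
  next
    case 2
    have mid: "bellman (1 / 2 + v - h) = mid (v - h)" using 2(2) unfolding xy(3) .
    show ?thesis
    proof (cases "y \<le> 1 / 2")
      case True
      show ?thesis unfolding xy(1) xy(2)
        using True assms hv by (intro two_point_mid_low mid) auto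
    next
      case False
      show ?thesis unfolding xy(1) xy(2)
        using False 2(1) assms hv by (intro two_point_mid_high mid) auto
    qed
  next
    case 3
    show ?thesis unfolding xy(1) xy(2)
      using 3 assms hv by (intro two_point_straddling) auto
  next
    case 4
    have e: "v - (y - x) / 2 = (x + y) / 2 - 1 / 2" "v - (y - x) = x - 1 / 2" "v = y - 1 / 2"
      using hv by (simp_all add: field_simps)
    have "bellman ((x + y) / 2) = tail (v - (y - x) / 2)"
      unfolding e(1) using 4 assms by (intro bellman_upper_half) auto
    moreover have "bellman x = tail (v - (y - x))"
      unfolding e(2) using 4 assms by (intro bellman_upper_half) auto
    moreover have "bellman y = tail v"
      unfolding e(3) using 4 assms by (intro bellman_upper_half) auto
    ultimately have B: "bellman ((x + y) / 2) = tail (v - (y - x) / 2)" "bellman x = tail (v - (y - x))"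
      "bellman y = tail v" .
    have "(2 * tail (v - (y - x) / 2) - tail (v - (y - x)))\<^sup>2 \<le> (y - x)\<^sup>2 + (tail v)\<^sup>2"
      using 4 assms hv by (intro tail_two_point) auto
    then show ?thesis
      by (intro two_point_if_near[OF order_refl]) (simp only: B)
  qed
qed

theorem theorem1p5:
  shows "(\<forall>k::nat. k \<ge> 1 \<longrightarrow>
            ereal (1 / 2 ^ k * sqrt (real k)) \<ge> iso_profile (1/2) (1 / 2 ^ k) \<and>
            iso_profile (1/2) (1 / 2 ^ k) \<ge> ereal (0.997 * (1 / 2 ^ k) * sqrt (real k))) \<and>
         ereal 0.5 \<ge> iso_profile (1/2) (1/2) \<and>
         iso_profile (1/2) (1/2) \<ge> ereal 0.4985"
proof -
  have lower: "ereal (0.997 * (1 / 2 ^ k) * sqrt (real k)) \<le> iso_profile (1/2) (1 / 2 ^ k)"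
    if "k \<ge> 1" for k :: nat
  proof (rule iso_profile_half_ge)
    fix n A assume A: "A \<subseteq> cube n" "cube_density n A = 1 / 2 ^ k"
    have "(2 :: real) ^ 1 \<le> 2 ^ k" using that by (intro power_increasing) auto
    then have "1 / 2 ^ k \<le> (1 / 2 :: real)" by (simp add: field_simps)
    have "0.997 * (1 / 2 ^ k) * sqrt (real k) = 997 / 1000 * ell (1 / 2 ^ k)"
      by (simp add: ell_def log_pow_cancel)
    also have "\<dots> \<le> bellman (1 / 2 ^ k)"
      using \<open>1 / 2 ^ k \<le> (1 / 2 :: real)\<close> by (rule bellman_ge_ell)
    also have "\<dots> \<le> root_mean n A"
      using two_point_induction[of bellman A n] A bellman_two_point bellman_nonneg
      by (simp add: bellman_0 bellman_1)
    finally show "0.997 * (1 / 2 ^ k) * sqrt (real k) \<le> root_mean n A" .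
  qed
  from lower[of 1] iso_profile_subcube_le[of 1] have
    "iso_profile (1/2) (1/2) \<le> ereal 0.5" "ereal 0.4985 \<le> iso_profile (1/2) (1/2)"
    by simp_all
  with lower iso_profile_subcube_le show ?thesis by blast
qed

end
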